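(* Let $n\in\mathbb{N}$ and let $\mathfrak{g}_{2n+2}$ be the complex Lie algebra with basis $\{X_0,\dots,X_n,Y_0,\dots,Y_n\}$ and non-zero Lie brackets $[Y_0,X_i]=X_i$, $[Y_0,Y_i]=-Y_i$, $[X_i,Y_i]=X_0$ for $1\le i\le n$. Let $b_k=\dim H^k(\mathfrak{g}_{2n+2},\mathbb{C})$ for integers $k\geq 0$. Then: (1) If $k$ is even, then $$b_k=\left|\binom{n}{\frac{k}{2}}^2-\binom{n}{\frac{k-2}{2}}^2\right|.$$ (2) If $k$ is odd, then - if $k<n+1$, then $\displaystyle b_k=\binom{n}{\frac{k-1}{2}}^2-\binom{n}{\frac{k-3}{2}}^2$; - if $k=n+1$, then $\displaystyle b_{n+1}=2\binom{n}{\frac{n}{2}}^2-2\binom{n}{\frac{n+2}{2}}^2$; - if $k>n+1$, then $\displaystyle b_k=\binom{n}{\frac{k-1}{2}}^2-\binom{n}{\frac{k+1}{2}}^2$.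
   Context: $H^k(\mathfrak{g},\mathbb{C})$ denotes the $k$-th Lie algebra (Chevalley–Eilenberg) cohomology group of $\mathfrak{g}$ with coefficients in the trivial module $\mathbb{C}$; its dimension $b_k$ is the $k$-th Betti number. A binomial coefficient $\binom{n}{j}$ with $j<0$ or $j>n$ is $0$. *)

theory Defs
  imports Complex_Main "HOL-Algebra.AbelCoset" "Jordan_Normal_Form.VS_Connect"
begin

text \<open>
  The fields \<open>mult\<close> and \<open>one\<close> of a \<open>module\<close> record play no role for a module; they are \<open>undefined\<close>.
  Scaling a coset by \<open>c\<close> adds \<open>N\<close> again, so that \<open>0\<close> times a coset is \<open>N\<close> and not \<open>{0}\<close>.
\<close>
definition quotient_module :: "('k, 'v) module \<Rightarrow> 'v set \<Rightarrow> ('k, 'v set) module" where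
  "quotient_module M N =
    \<lparr>carrier = a_rcosets\<^bsub>M\<^esub> N, mult = undefined, one = undefined,
     zero = N, add = (<+>\<^bsub>M\<^esub>), smult = (\<lambda>c S. \<Union>v\<in>S. N +>\<^bsub>M\<^esub> (c \<odot>\<^bsub>M\<^esub> v))\<rparr>"

locale lie_algebra = vector_space scale
  for scale :: "'k::field \<Rightarrow> 'a::ab_group_add \<Rightarrow> 'a" +
  fixes bracket :: "'a \<Rightarrow> 'a \<Rightarrow> 'a"
  assumes bracket_linear_left: "Vector_Spaces.linear scale scale (\<lambda>x. bracket x y)"
    and bracket_linear_right: "Vector_Spaces.linear scale scale (\<lambda>y. bracket x y)"
    and bracket_self: "bracket x x = 0"
    and jacobi: "bracket x (bracket y z) + bracket y (bracket z x) + bracket z (bracket x y) = 0"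
begin

text \<open>
  The Chevalley--Eilenberg complex with coefficients in the trivial module \<open>'k\<close>. A \<open>k\<close>-cochain,
  i.e. an alternating \<open>k\<close>-linear form, is a function on lists that is only meaningful on lists of
  length \<open>k\<close> and is made \<open>0\<close> elsewhere, so that distinct functions are distinct cochains.
\<close>
definition cochains :: "nat \<Rightarrow> ('a list \<Rightarrow> 'k) set" where
  "cochains k = {f.
     (\<forall>xs. length xs \<noteq> k \<longrightarrow> f xs = 0) \<and>
     (\<forall>xs i. length xs = k \<longrightarrow> i < k \<longrightarrow> Vector_Spaces.linear scale (*) (\<lambda>x. f (xs[i := x]))) \<and>
     (\<forall>xs. length xs = k \<longrightarrow> \<not> distinct xs \<longrightarrow> f xs = 0)}"

text \<open>
  \<open>nths xs (- {i, j})\<close> is \<open>xs\<close> with the entries at positions \<open>i\<close> and \<open>j\<close> deleted. The terms in which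
  \<open>x\<^sub>i\<close> acts on a value of \<open>f\<close> vanish because the coefficients are trivial.
\<close>
definition differential :: "('a list \<Rightarrow> 'k) \<Rightarrow> 'a list \<Rightarrow> 'k" where
  "differential f xs =
    (\<Sum>(i, j) \<in> {(i, j). i < j \<and> j < length xs}.
       (- 1) ^ (i + j) * f (bracket (xs ! i) (xs ! j) # nths xs (- {i, j})))"

definition cocycles :: "nat \<Rightarrow> ('a list \<Rightarrow> 'k) set" where
  "cocycles k = {f \<in> cochains k. differential f = (\<lambda>_. 0)}"

definition coboundaries :: "nat \<Rightarrow> ('a list \<Rightarrow> 'k) set" where
  "coboundaries k = (case k of 0 \<Rightarrow> {\<lambda>_. 0} | Suc j \<Rightarrow> differential ` cochains j)"

definition cocycle_space :: "nat \<Rightarrow> ('k, 'a list \<Rightarrow> 'k) module" where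
  "cocycle_space k =
    \<lparr>carrier = cocycles k, mult = undefined, one = undefined,
     zero = (\<lambda>_. 0), add = (\<lambda>f g xs. f xs + g xs), smult = (\<lambda>c f xs. c * f xs)\<rparr>"

definition cohomology :: "nat \<Rightarrow> ('k, ('a list \<Rightarrow> 'k) set) module" where
  "cohomology k = quotient_module (cocycle_space k) (coboundaries k)"

definition betti :: "nat \<Rightarrow> nat" where
  "betti k = vectorspace.dim class_ring (cohomology k)"

end

text \<open>
  Brackets of basis vectors not listed here are determined by antisymmetry.
\<close>
locale diamond_lie_algebra = lie_algebra scale bracket
  for scale :: "complex \<Rightarrow> 'a::ab_group_add \<Rightarrow> 'a" and bracket :: "'a \<Rightarrow> 'a \<Rightarrow> 'a" +
  fixes n :: nat and X Y :: "nat \<Rightarrow> 'a"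
  assumes inj_X: "inj_on X {0..n}"
    and inj_Y: "inj_on Y {0..n}"
    and disjoint_X_Y: "X ` {0..n} \<inter> Y ` {0..n} = {}"
    and independent_X_Y: "independent (X ` {0..n} \<union> Y ` {0..n})"
    and span_X_Y: "span (X ` {0..n} \<union> Y ` {0..n}) = UNIV"
    and bracket_Y0_X: "i \<in> {1..n} \<Longrightarrow> bracket (Y 0) (X i) = X i"
    and bracket_Y0_Y: "i \<in> {1..n} \<Longrightarrow> bracket (Y 0) (Y i) = - Y i"
    and bracket_X_Y_same: "i \<in> {1..n} \<Longrightarrow> bracket (X i) (Y i) = X 0"
    and bracket_X_Y_diff: "i \<in> {1..n} \<Longrightarrow> j \<in> {1..n} \<Longrightarrow> i \<noteq> j \<Longrightarrow> bracket (X i) (Y j) = 0"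
    and bracket_X_X: "i \<in> {0..n} \<Longrightarrow> j \<in> {0..n} \<Longrightarrow> bracket (X i) (X j) = 0"
    and bracket_Y_Y: "i \<in> {1..n} \<Longrightarrow> j \<in> {1..n} \<Longrightarrow> bracket (Y i) (Y j) = 0"
    and bracket_X0_Y: "j \<in> {0..n} \<Longrightarrow> bracket (X 0) (Y j) = 0"

text \<open>
  The lower index is an integer because it may be negative; for \<open>j > n\<close> the value of \<open>choose\<close>
  is already \<open>0\<close>.
\<close>
definition binom :: "nat \<Rightarrow> int \<Rightarrow> int" where
  "binom n j = (if j < 0 then 0 else int (n choose nat j))"

end

theory Submission
  imports Defs
begin

text \<open>
  Write a cochain in terms of the dual basis vectors \<open>x\<^sub>i\<close>, \<open>y\<^sub>i\<close> of \<open>X\<^sub>i\<close>, \<open>Y\<^sub>i\<close> as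
  \<open>a + x\<^sub>0 b + y\<^sub>0 c + x\<^sub>0 y\<^sub>0 e\<close> with \<open>a, b, c, e\<close> in the exterior algebra \<open>\<Lambda>\<close> on the \<open>x\<^sub>i\<close>, \<open>y\<^sub>i\<close> with
  \<open>i \<ge> 1\<close>. Let \<open>L\<close> be the multiplication by \<open>\<Sum> x\<^sub>i y\<^sub>i\<close> on \<open>\<Lambda>\<close>, and let \<open>w\<close> be the weight operator, which
  multiplies a monomial by its number of factors \<open>x\<^sub>i\<close> minus its number of factors \<open>y\<^sub>i\<close>. The cochain is closed iff
  \<open>L b = 0\<close>, \<open>w b = 0\<close> and \<open>w a + L e = 0\<close>. Outside weight \<open>0\<close> these equations just say that \<open>b\<close> vanishes and
  that \<open>a\<close> is determined by \<open>e\<close>, while in weight \<open>0\<close> they say \<open>L b = L e = 0\<close>. Weight \<open>0\<close> and degree \<open>2 m\<close>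
  has dimension \<open>(n choose m)\<^sup>2\<close> in \<open>\<Lambda>\<close>. The commutator of the adjoint of \<open>L\<close> with \<open>L\<close> is \<open>n - j\<close> in degree \<open>j\<close>,
  and by positivity of the inner product \<open>L\<close> is injective in degrees \<open>j < n\<close> and surjective from degrees
  \<open>j \<ge> n\<close>. This gives the dimension of every space of cocycles, hence all Betti numbers.
\<close>

section \<open>Dimensions of spaces of functions\<close>

text \<open>An independent subset of \<open>W\<close> has at most \<open>dim\<close> elements, so an
  inclusion-maximal one exists, and such a set is a basis of \<open>W\<close>. That \<open>W\<close>
  is itself finite-dimensional is a consequence.\<close>

lemma (in vectorspace) maximal_independent_subset:
  assumes "fin_dim" "subspace K W V"
  obtains A where "finite A" "A \<subseteq> W" "lin_indpt A" "vectorspace.basis K (vs W) A"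
proof -
  interpret W: vectorspace K "vs W"
    using assms(2) by (rule subspace_is_vs)
  have sub: "submodule K W V" using assms(2) by simp
  have WV: "W \<subseteq> carrier V" using sub by (simp add: submodule_def)
  have li: "W.lin_dep A = lin_dep A" if "A \<subseteq> W" for A
    using that sub span_li_not_depend(2) by blast
  have "\<exists>A. finite A \<and> maximal A (\<lambda>S. S \<subseteq> carrier (vs W) \<and> W.lin_indpt S)"
  proof (rule maximal_exists[where ?N = "dim" and ?B = "{}"])
    show "\<And>B. B \<subseteq> carrier (vs W) \<and> W.lin_indpt B \<Longrightarrow> finite B \<and> card B \<le> dim"
      using li WV li_le_dim assms(1) by (metis carrier_vs_is_self order_trans)
    show "{} \<subseteq> carrier (vs W) \<and> W.lin_indpt {}"
      by (auto simp: W.lin_dep_def)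
  qed
  then obtain A where A: "finite A" "maximal A (\<lambda>S. S \<subseteq> carrier (vs W) \<and> W.lin_indpt S)"
    by blast
  have "W.basis A" using A(2) by (rule W.max_li_is_basis)
  moreover have "A \<subseteq> W" "W.lin_indpt A" using A(2) by (auto simp: maximal_def)
  ultimately show ?thesis using that A(1) li by blast
qed

lemma (in vectorspace) fin_dim_subspace:
  assumes "fin_dim" "subspace K W V"
  shows "vectorspace.fin_dim K (vs W)"
proof -
  interpret W: vectorspace K "vs W"
    using assms(2) by (rule subspace_is_vs)
  from maximal_independent_subset[OF assms] obtain A where "finite A" "W.basis A" by metis
  then show ?thesis unfolding W.fin_dim_def W.basis_def by blast
qed

text \<open>A basis of \<open>W\<close> stays independent in the whole space and has
  \<open>dim\<close> elements, so it spans the whole space.\<close>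

lemma (in vectorspace) subspace_eq_carrier:
  assumes "fin_dim" "subspace K W V" "vectorspace.dim K (vs W) = dim"
  shows "W = carrier V"
proof -
  interpret W: vectorspace K "vs W"
    using assms(2) by (rule subspace_is_vs)
  have sub: "submodule K W V" using assms(2) by simp
  have WV: "W \<subseteq> carrier V" using sub by (simp add: submodule_def)
  obtain A where A: "finite A" "A \<subseteq> W" "lin_indpt A" "W.basis A"
    using maximal_independent_subset[OF assms(1,2)] by metis
  have "basis A"
    using A WV assms(1,3) W.dim_basis[OF A(1,4)] by (intro dim_li_is_basis) auto
  then have "span A = carrier V" by (simp add: basis_def)
  moreover have "W.span A = W" using A(4) by (simp add: W.basis_def)
  moreover have "W.span A = span A"
    using A(2) sub span_li_not_depend(1) by blast
  ultimately show ?thesis by simp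
qed

section \<open>Vector spaces of functions with pointwise operations\<close>

definition linear_set :: "('x \<Rightarrow> 'k::field) set \<Rightarrow> bool" where
  "linear_set C \<longleftrightarrow> (\<lambda>_. 0) \<in> C \<and> (\<forall>f\<in>C. \<forall>g\<in>C. (\<lambda>x. f x + g x) \<in> C) \<and> (\<forall>c. \<forall>f\<in>C. (\<lambda>x. c * f x) \<in> C)"

text \<open>The record has the shape of \<open>cocycle_space\<close>, so that the two agree on the
  set of cocycles and every dimension can be computed with \<open>fspace\<close>.\<close>

definition fspace :: "('x \<Rightarrow> 'k::field) set \<Rightarrow> ('k, 'x \<Rightarrow> 'k) module" where
  "fspace C = \<lparr>carrier = C, mult = undefined, one = undefined,
     zero = (\<lambda>_. 0), add = (\<lambda>f g x. f x + g x), smult = (\<lambda>c f x. c * f x)\<rparr>"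

lemma fspace_simps [simp]:
  "carrier (fspace C) = C" "zero (fspace C) = (\<lambda>_. 0)" "add (fspace C) = (\<lambda>f g x. f x + g x)"
  "smult (fspace C) = (\<lambda>c f x. c * f x)" "(fspace C)\<lparr>carrier := D\<rparr> = fspace D"
  by (simp_all add: fspace_def)

lemma linear_setD:
  assumes "linear_set C"
  shows "(\<lambda>_. 0) \<in> C" "f \<in> C \<Longrightarrow> g \<in> C \<Longrightarrow> (\<lambda>x. f x + g x) \<in> C" "f \<in> C \<Longrightarrow> (\<lambda>x. c * f x) \<in> C"
    "f \<in> C \<Longrightarrow> (\<lambda>x. - f x) \<in> C"
proof -
  have "\<forall>c. \<forall>f\<in>C. (\<lambda>x. c * f x) \<in> C" using assms by (simp add: linear_set_def)
  from spec[OF this, of "- 1"] show "f \<in> C \<Longrightarrow> (\<lambda>x. - f x) \<in> C" by simp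
qed (use assms in \<open>simp_all add: linear_set_def\<close>)

lemma module_class_ringI:
  fixes M :: "('k::field, 'v) module"
  assumes "abelian_group M"
    and "\<And>c v. v \<in> carrier M \<Longrightarrow> c \<odot>\<^bsub>M\<^esub> v \<in> carrier M"
    and "\<And>a b v. v \<in> carrier M \<Longrightarrow> (a + b) \<odot>\<^bsub>M\<^esub> v = a \<odot>\<^bsub>M\<^esub> v \<oplus>\<^bsub>M\<^esub> b \<odot>\<^bsub>M\<^esub> v"
    and "\<And>a v w. v \<in> carrier M \<Longrightarrow> w \<in> carrier M \<Longrightarrow> a \<odot>\<^bsub>M\<^esub> (v \<oplus>\<^bsub>M\<^esub> w) = a \<odot>\<^bsub>M\<^esub> v \<oplus>\<^bsub>M\<^esub> a \<odot>\<^bsub>M\<^esub> w"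
    and "\<And>a b v. v \<in> carrier M \<Longrightarrow> (a * b) \<odot>\<^bsub>M\<^esub> v = a \<odot>\<^bsub>M\<^esub> (b \<odot>\<^bsub>M\<^esub> v)"
    and "\<And>v. v \<in> carrier M \<Longrightarrow> 1 \<odot>\<^bsub>M\<^esub> v = v"
  shows "vectorspace class_ring M"
proof -
  have "module class_ring M"
    by (rule moduleI[OF class_cring.is_cring assms(1)]) (use assms in auto)
  then show ?thesis by (simp add: vectorspace_def class_field)
qed

lemma abelian_group_fspace:
  assumes "linear_set C"
  shows "abelian_group (fspace C)"
proof (rule abelian_groupI)
  fix f assume "f \<in> carrier (fspace C)"
  then have "(\<lambda>x. - f x) \<in> carrier (fspace C)"
    using linear_setD(4)[OF assms] by simp
  then show "\<exists>g\<in>carrier (fspace C). g \<oplus>\<^bsub>fspace C\<^esub> f = \<zero>\<^bsub>fspace C\<^esub>"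
    by (rule bexI[rotated]) auto
qed (simp_all add: linear_setD[OF assms] add_ac)

lemma vectorspace_fspace:
  assumes "linear_set C"
  shows "vectorspace class_ring (fspace C)"
  by (rule module_class_ringI[OF abelian_group_fspace[OF assms]])
     (simp_all add: linear_setD[OF assms] distrib_left distrib_right mult.assoc)

abbreviation fdim :: "('x \<Rightarrow> 'k::field) set \<Rightarrow> nat" where
  "fdim C \<equiv> vectorspace.dim class_ring (fspace C)"

abbreviation finite_dim :: "('x \<Rightarrow> 'k::field) set \<Rightarrow> bool" where
  "finite_dim C \<equiv> vectorspace.fin_dim class_ring (fspace C)"

lemma subspace_fspace:
  assumes "linear_set C" "linear_set D" "D \<subseteq> C"
  shows "subspace class_ring D (fspace C)"
  using vectorspace_fspace[OF assms(1)] assms(2,3)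
  by (auto simp: subspace_def submodule_def vectorspace_def linear_setD)

lemma finite_dim_subset:
  assumes "linear_set C" "linear_set D" "D \<subseteq> C" "finite_dim C"
  shows "finite_dim D"
  using vectorspace.fin_dim_subspace[OF vectorspace_fspace[OF assms(1)] assms(4) subspace_fspace[OF assms(1-3)]]
  by simp

lemma fdim_eq_imp_eq:
  assumes "linear_set C" "linear_set D" "D \<subseteq> C" "finite_dim C" "fdim D = fdim C"
  shows "D = C"
  using vectorspace.subspace_eq_carrier[OF vectorspace_fspace[OF assms(1)] assms(4) subspace_fspace[OF assms(1-3)]]
    assms(5) by simp

text \<open>Linearity is asked on \<open>C\<close> only and no codomain is fixed; in rank-nullity
  the target is the image of \<open>C\<close>.\<close>

definition linear_map_on :: "('x \<Rightarrow> 'k::field) set \<Rightarrow> (('x \<Rightarrow> 'k) \<Rightarrow> ('y \<Rightarrow> 'k)) \<Rightarrow> bool" where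
  "linear_map_on C T \<longleftrightarrow> (\<forall>f\<in>C. \<forall>g\<in>C. T (\<lambda>x. f x + g x) = (\<lambda>y. T f y + T g y)) \<and>
     (\<forall>c. \<forall>f\<in>C. T (\<lambda>x. c * f x) = (\<lambda>y. c * T f y))"

lemma linear_map_on_zero:
  assumes "linear_set C" "linear_map_on C T"
  shows "T (\<lambda>_. 0) = (\<lambda>_. 0)"
proof -
  have "\<forall>c. \<forall>f\<in>C. T (\<lambda>x. c * f x) = (\<lambda>y. c * T f y)"
    using assms(2) unfolding linear_map_on_def by blast
  from bspec[OF spec[OF this, of 0] linear_setD(1)[OF assms(1)]] show ?thesis by simp
qed

lemma linear_map_onD:
  assumes "linear_map_on C T"
  shows "f \<in> C \<Longrightarrow> g \<in> C \<Longrightarrow> T (\<lambda>x. f x + g x) = (\<lambda>y. T f y + T g y)"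
    and "f \<in> C \<Longrightarrow> T (\<lambda>x. c * f x) = (\<lambda>y. c * T f y)"
  using assms by (simp_all add: linear_map_on_def)

lemma linear_set_image:
  assumes "linear_set C" "linear_map_on C T"
  shows "linear_set (T ` C)"
  unfolding linear_set_def
proof (intro conjI ballI allI)
  show "(\<lambda>_. 0) \<in> T ` C"
    by (rule image_eqI[OF _ linear_setD(1)[OF assms(1)]]) (simp add: linear_map_on_zero[OF assms])
next
  fix f g assume "f \<in> T ` C" "g \<in> T ` C"
  then obtain f' g' where *: "f' \<in> C" "g' \<in> C" "f = T f'" "g = T g'" by auto
  show "(\<lambda>x. f x + g x) \<in> T ` C"
    by (rule image_eqI[OF _ linear_setD(2)[OF assms(1) *(1,2)]])
       (simp add: * linear_map_onD(1)[OF assms(2) *(1,2)])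
next
  fix c f assume "f \<in> T ` C"
  then obtain f' where "f' \<in> C" "f = T f'" by auto
  then show "(\<lambda>x. c * f x) \<in> T ` C"
    by (intro image_eqI[OF _ linear_setD(3)[OF assms(1)]]) (simp_all add: linear_map_onD(2)[OF assms(2)])
qed

lemma linear_set_kernel:
  assumes "linear_set C" "linear_map_on C T"
  shows "linear_set {f \<in> C. T f = (\<lambda>_. 0)}"
  using assms linear_map_on_zero[OF assms] unfolding linear_set_def linear_map_on_def by simp

lemma linear_map_fspace:
  assumes "linear_set C" "linear_map_on C T"
  shows "linear_map class_ring (fspace C) (fspace (T ` C)) T"
proof -
  interpret C: vectorspace class_ring "fspace C" using assms(1) by (rule vectorspace_fspace)
  interpret D: vectorspace class_ring "fspace (T ` C)"
    by (intro vectorspace_fspace linear_set_image assms)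
  show ?thesis
    by unfold_locales (use assms(2) in \<open>simp add: LinearCombinations.module_hom_def linear_map_on_def\<close>)
qed

lemma fdim_rank_nullity:
  assumes "linear_set C" "linear_map_on C T" "finite_dim C"
  shows "fdim (T ` C) + fdim {f \<in> C. T f = (\<lambda>_. 0)} = fdim C" "finite_dim (T ` C)"
proof -
  interpret linear_map class_ring "fspace C" "fspace (T ` C)" T
    using assms(1,2) by (rule linear_map_fspace)
  have "ker = {f \<in> C. T f = (\<lambda>_. 0)}" "im = T ` C"
    by (auto simp: ker_def im_def)
  then show "fdim (T ` C) + fdim {f \<in> C. T f = (\<lambda>_. 0)} = fdim C"
    using rank_nullity[OF assms(3)] by simp
  show "finite_dim (T ` C)"
    using rank_nullity_main(2)[OF assms(3)] by simp
qed

section \<open>Coordinate spaces, rank-nullity and quotients\<close>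

definition supported_on :: "'x set \<Rightarrow> ('x \<Rightarrow> 'k::field) set" where
  "supported_on I = {f. \<forall>x. x \<notin> I \<longrightarrow> f x = 0}"

lemma linear_set_supported_on [simp]: "linear_set (supported_on I)"
  by (simp add: linear_set_def supported_on_def)

text \<open>An enumeration of \<open>I\<close> turns column vectors of length \<open>card I\<close>
  into functions on \<open>I\<close> extended by zero. This is an isomorphism from a space of known
  dimension.\<close>

lemma fdim_supported_on:
  assumes "finite I"
  shows "fdim (supported_on I :: ('x \<Rightarrow> 'k::field) set) = card I"
    "finite_dim (supported_on I :: ('x \<Rightarrow> 'k::field) set)"
proof -
  let ?n = "card I"
  obtain e where e: "bij_betw e {0..<?n} I"
    using ex_bij_betw_nat_finite[OF assms] by blast
  interpret V: vec_space "TYPE('k)" ?n .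
  let ?T = "\<lambda>v x. if x \<in> I then v $ (the_inv_into {0..<?n} e x) else (0::'k)"
  have inv: "the_inv_into {0..<?n} e x < ?n" if "x \<in> I" for x
    using that e the_inv_into_into[of e "{0..<?n}" x "{0..<?n}"] by (auto simp: bij_betw_def)
  have inve: "the_inv_into {0..<?n} e (e i) = i" if "i < ?n" for i
    using that e by (auto simp: bij_betw_def the_inv_into_f_f)
  have eI: "e i \<in> I" if "i < ?n" for i using that e by (auto simp: bij_betw_def)
  interpret W: vectorspace class_ring "fspace (supported_on I :: ('x \<Rightarrow> 'k) set)"
    by (intro vectorspace_fspace linear_set_supported_on)
  interpret L: linear_map class_ring V.V "fspace (supported_on I :: ('x \<Rightarrow> 'k) set)" ?T
    by unfold_locales (auto simp: LinearCombinations.module_hom_def supported_on_def inv module_vec_simps)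
  have inj: "inj_on ?T (carrier V.V)"
  proof (rule inj_onI)
    fix v w assume vw: "v \<in> carrier V.V" "w \<in> carrier V.V" "?T v = ?T w"
    have "v $ i = w $ i" if "i < ?n" for i
      using fun_cong[OF vw(3), of "e i"] eI[OF that] inve[OF that] by simp
    then show "v = w" using vw by (intro eq_vecI) (auto simp: module_vec_simps)
  qed
  have surj: "?T ` carrier V.V = carrier (fspace (supported_on I))"
  proof (intro equalityI subsetI)
    fix f :: "'x \<Rightarrow> 'k" assume f: "f \<in> carrier (fspace (supported_on I))"
    have "e (the_inv_into {0..<?n} e x) = x" if "x \<in> I" for x
      using that e by (auto simp: bij_betw_def f_the_inv_into_f)
    then have "f = ?T (vec ?n (\<lambda>i. f (e i)))"
      using f inv by (auto simp: supported_on_def fun_eq_iff)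
    then show "f \<in> ?T ` carrier V.V" by (auto simp: module_vec_simps)
  qed (auto simp: supported_on_def)
  show "fdim (supported_on I :: ('x \<Rightarrow> 'k) set) = card I"
    using L.dim_eq[OF V.fin_dim inj surj] V.dim_is_n by simp
  show "finite_dim (supported_on I :: ('x \<Rightarrow> 'k) set)"
    by (rule L.surj_fin_dim[OF V.fin_dim surj])
qed

text \<open>Rank-nullity for a surjection onto a coordinate space: independent linear conditions
  indexed by \<open>I\<close> lower the dimension by \<open>card I\<close>.\<close>

lemma fdim_kernel_supported_on:
  assumes "linear_set C" "linear_map_on C T" "finite_dim C" "T ` C = supported_on I" "finite I"
  shows "fdim {f \<in> C. T f = (\<lambda>_. 0)} + card I = fdim C"
  using fdim_rank_nullity(1)[OF assms(1-3)] assms(4) by (simp add: fdim_supported_on(1)[OF assms(5)])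

text \<open>A zero kernel gives the image full dimension, and a subspace of full dimension is
  everything.\<close>

lemma injective_supported_on_imp_surjective:
  fixes T :: "('x \<Rightarrow> 'k::field) \<Rightarrow> ('x \<Rightarrow> 'k)"
  assumes "finite I" "linear_map_on (supported_on I) T" "T ` supported_on I \<subseteq> supported_on I"
    and "\<And>f. f \<in> supported_on I \<Longrightarrow> T f = (\<lambda>_. 0) \<Longrightarrow> f = (\<lambda>_. 0)"
  shows "T ` supported_on I = supported_on I"
proof -
  let ?C = "supported_on I :: ('x \<Rightarrow> 'k) set"
  have fin: "finite_dim ?C" using assms(1) by (rule fdim_supported_on(2))
  have "{f \<in> ?C. T f = (\<lambda>_. 0)} = {\<lambda>_. 0}"
    using assms(4) linear_map_on_zero[OF linear_set_supported_on assms(2)] linear_setD(1)[OF linear_set_supported_on]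
    by blast
  also have "\<dots> = supported_on {}" by (auto simp: supported_on_def)
  finally have "fdim (T ` ?C) = fdim ?C"
    using fdim_rank_nullity(1)[OF linear_set_supported_on assms(2) fin]
    by (simp add: fdim_supported_on(1))
  then show ?thesis
    using fdim_eq_imp_eq[OF linear_set_supported_on linear_set_image[OF _ assms(2)] assms(3) fin] by simp
qed

text \<open>The projection to cosets is linear and onto with kernel \<open>N\<close>, so
  rank-nullity applies to it.\<close>

lemma dim_quotient_fspace:
  fixes C N :: "('x \<Rightarrow> 'k::field) set"
  assumes C: "linear_set C" and N: "linear_set N" and NC: "N \<subseteq> C" and fin: "finite_dim C"
  shows "vectorspace.dim class_ring (quotient_module (fspace C) N) + fdim N = fdim C"
proof -
  let ?Q = "quotient_module (fspace C) N"
  interpret V: vectorspace class_ring "fspace C" using C by (rule vectorspace_fspace)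
  interpret N: abelian_subgroup N "fspace C"
  proof (rule abelian_subgroupI3)
    show "additive_subgroup N (fspace C)"
    proof (rule additive_subgroupI, rule V.add.subgroupI)
      fix f assume f: "f \<in> N"
      then have "\<ominus>\<^bsub>fspace C\<^esub> f = (\<lambda>x. - f x)"
        using NC linear_setD(4)[OF N f] by (intro V.minus_equality) auto
      then show "\<ominus>\<^bsub>fspace C\<^esub> f \<in> N" using linear_setD(4)[OF N f] by simp
    qed (use N NC linear_setD[OF N] in auto)
    show "abelian_group (fspace C)" using C by (rule abelian_group_fspace)
  qed
  let ?pr = "\<lambda>f. N +>\<^bsub>fspace C\<^esub> f"
  have carr: "carrier ?Q = ?pr ` C"
    by (auto simp: quotient_module_def A_RCOSETS_def')
  have eq_iff: "?pr f = ?pr g \<longleftrightarrow> (\<lambda>x. f x - g x) \<in> N" if "f \<in> C" "g \<in> C" for f g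
  proof
    assume "?pr f = ?pr g"
    then have "f \<in> ?pr g" using N.a_rcos_self[of f] that by simp
    then show "(\<lambda>x. f x - g x) \<in> N" by (auto simp: a_r_coset_def')
  next
    assume "(\<lambda>x. f x - g x) \<in> N"
    then have "f \<in> ?pr g" by (force simp: a_r_coset_def')
    then show "?pr f = ?pr g" using V.a_repr_independence[of f N g] that N.a_subgroup by simp
  qed
  have add: "?pr f \<oplus>\<^bsub>?Q\<^esub> ?pr g = ?pr (\<lambda>x. f x + g x)" if "f \<in> C" "g \<in> C" for f g
    using N.a_rcos_sum[of f g] that by (simp add: quotient_module_def)
  have smult: "c \<odot>\<^bsub>?Q\<^esub> ?pr f = ?pr (\<lambda>x. c * f x)" if "f \<in> C" for c f
  proof -
    \<comment> \<open>A multiple of a coset is a union over all representatives \<open>g\<close>.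
      They all give the same coset, because \<open>N\<close> is closed under scaling.\<close>
    have "?pr (\<lambda>x. c * g x) = ?pr (\<lambda>x. c * f x)" if "g \<in> ?pr f" for g
    proof -
      obtain h where h: "h \<in> N" "g = (\<lambda>x. h x + f x)" using \<open>g \<in> ?pr f\<close> by (auto simp: a_r_coset_def')
      have "g \<in> C" using h NC C \<open>f \<in> C\<close> by (auto intro!: linear_setD)
      moreover have "(\<lambda>x. c * g x - c * f x) = (\<lambda>x. c * h x)" by (simp add: h algebra_simps)
      ultimately show ?thesis
        using eq_iff[of "\<lambda>x. c * g x" "\<lambda>x. c * f x"] \<open>f \<in> C\<close> linear_setD(3)[OF C]
          linear_setD(3)[OF N h(1)] by simp
    qed
    moreover have "f \<in> ?pr f" using N.a_rcos_self[of f] that by simp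
    ultimately have "(\<Union>g\<in>?pr f. ?pr (\<lambda>x. c * g x)) = ?pr (\<lambda>x. c * f x)" by blast
    then show ?thesis by (simp add: quotient_module_def)
  qed
  have zero: "\<zero>\<^bsub>?Q\<^esub> = ?pr (\<lambda>_. 0)"
    by (simp add: quotient_module_def a_r_coset_def')
  have ag: "abelian_group ?Q"
  proof (rule abelian_groupI)
    fix a assume "a \<in> carrier ?Q"
    then obtain f where f: "f \<in> C" "a = ?pr f" by (auto simp: carr)
    have "?pr (\<lambda>x. - f x) \<oplus>\<^bsub>?Q\<^esub> a = \<zero>\<^bsub>?Q\<^esub>"
      using f linear_setD(4)[OF C f(1)] by (simp add: add zero)
    then show "\<exists>b\<in>carrier ?Q. b \<oplus>\<^bsub>?Q\<^esub> a = \<zero>\<^bsub>?Q\<^esub>"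
      using linear_setD(4)[OF C f(1)] carr by blast
  qed (auto simp: carr add zero linear_setD[OF C] add_ac)
  interpret Q: vectorspace class_ring ?Q
  proof (rule module_class_ringI[OF ag])
    fix a b v assume "v \<in> carrier ?Q"
    then obtain f where f: "f \<in> C" "v = ?pr f" by (auto simp: carr)
    note [simp] = f(1) linear_setD(3)[OF C f(1)]
    show "a \<odot>\<^bsub>?Q\<^esub> v \<in> carrier ?Q" by (simp add: f(2) smult carr)
    show "(a + b) \<odot>\<^bsub>?Q\<^esub> v = a \<odot>\<^bsub>?Q\<^esub> v \<oplus>\<^bsub>?Q\<^esub> b \<odot>\<^bsub>?Q\<^esub> v"
      by (simp add: f(2) smult add distrib_right)
    show "(a * b) \<odot>\<^bsub>?Q\<^esub> v = a \<odot>\<^bsub>?Q\<^esub> (b \<odot>\<^bsub>?Q\<^esub> v)"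
      by (simp add: f(2) smult mult.assoc)
    show "1 \<odot>\<^bsub>?Q\<^esub> v = v" by (simp add: f(2) smult)
    fix w assume "w \<in> carrier ?Q"
    then obtain g where g: "g \<in> C" "w = ?pr g" by (auto simp: carr)
    note [simp] = g(1) linear_setD(3)[OF C g(1)] linear_setD(2)[OF C f(1) g(1)]
    show "a \<odot>\<^bsub>?Q\<^esub> (v \<oplus>\<^bsub>?Q\<^esub> w) = a \<odot>\<^bsub>?Q\<^esub> v \<oplus>\<^bsub>?Q\<^esub> a \<odot>\<^bsub>?Q\<^esub> w"
      by (simp add: f(2) g(2) smult add distrib_left)
  qed
  have hom: "?pr \<in> LinearCombinations.module_hom class_ring (fspace C) ?Q"
    unfolding LinearCombinations.module_hom_def mem_Collect_eq
  proof (intro conjI allI impI)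
    show "?pr \<in> carrier (fspace C) \<rightarrow> carrier ?Q" unfolding carr by simp
  next
    fix f g assume "f \<in> carrier (fspace C) \<and> g \<in> carrier (fspace C)"
    then show "?pr (f \<oplus>\<^bsub>fspace C\<^esub> g) = ?pr f \<oplus>\<^bsub>?Q\<^esub> ?pr g"
      using add[of f g] by simp
  next
    fix c :: "'k" and f assume "c \<in> carrier class_ring \<and> f \<in> carrier (fspace C)"
    then show "?pr (c \<odot>\<^bsub>fspace C\<^esub> f) = c \<odot>\<^bsub>?Q\<^esub> ?pr f"
      using smult[of f c] by simp
  qed
  have "linear_map class_ring (fspace C) ?Q ?pr"
    by (intro linear_map.intro mod_hom.intro mod_hom_axioms.intro hom
        V.vectorspace_axioms Q.vectorspace_axioms V.module_axioms Q.module_axioms)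
  then interpret P: linear_map class_ring "fspace C" ?Q ?pr .
  have "?pr f = \<zero>\<^bsub>?Q\<^esub> \<longleftrightarrow> f \<in> N" if "f \<in> C" for f
    using eq_iff[of f "\<lambda>_. 0"] that linear_setD(1)[OF C] by (simp add: zero)
  then have "P.ker = N" using NC by (auto simp: P.ker_def)
  moreover have "P.im = carrier ?Q" by (auto simp: P.im_def carr)
  ultimately show ?thesis using P.rank_nullity[OF fin] by simp
qed

section \<open>Alternating forms and the differential\<close>

lemma nths_cong:
  assumes "\<And>i. i < length xs \<Longrightarrow> i \<in> A \<longleftrightarrow> i \<in> B"
  shows "nths xs A = nths xs B"
  unfolding nths_def
  by (rule arg_cong[of _ _ "map fst"], rule filter_cong) (auto simp: set_zip assms)

lemma nths_append_Cons:
  "nths (as @ x # bs) A =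
     nths as A @ (if length as \<in> A then [x] else []) @ nths bs {j. Suc (j + length as) \<in> A}"
  by (simp add: nths_append nths_Cons)

lemma length_nths_delete2:
  assumes "i < j" "j < length xs"
  shows "length (nths xs (- {i, j})) = length xs - 2"
proof -
  have "{l. l < length xs \<and> l \<in> - {i, j}} = {..<length xs} - {i, j}" by auto
  then show ?thesis using assms by (simp add: length_nths card_Diff_subset)
qed

lemma nths_delete1:
  assumes "j < length xs"
  shows "nths xs (- {j}) = take j xs @ drop (Suc j) xs"
proof -
  have "nths (take j xs @ xs ! j # drop (Suc j) xs) (- {j}) = take j xs @ drop (Suc j) xs"
    using assms by (auto simp: nths_append_Cons nths_all)
  then show ?thesis using assms by (simp add: id_take_nth_drop[symmetric])
qed

context lie_algebra
begin

lemma linear_iff_add_scale: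
  "Vector_Spaces.linear scale (*) f \<longleftrightarrow>
     (\<forall>x y. f (x + y) = f x + f y) \<and> (\<forall>c x. f (scale c x) = c * f x)"
proof -
  have "vector_space ((*) :: 'k \<Rightarrow> 'k \<Rightarrow> 'k)"
    by unfold_locales (simp_all add: algebra_simps)
  then show ?thesis by (simp add: Vector_Spaces.linear_iff vector_space_axioms)
qed

lemma linear_sum:
  assumes "\<And>p. p \<in> A \<Longrightarrow> Vector_Spaces.linear scale (*) (T p)"
  shows "Vector_Spaces.linear scale (*) (\<lambda>x. \<Sum>p\<in>A. c p * T p x)"
  using assms by (simp add: linear_iff_add_scale distrib_left sum.distrib sum_distrib_left mult.left_commute)

section \<open>Multilinear and alternating forms on lists\<close>

definition multilinear :: "nat \<Rightarrow> ('a list \<Rightarrow> 'k) \<Rightarrow> bool" where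
  "multilinear k f \<longleftrightarrow> (\<forall>xs. length xs \<noteq> k \<longrightarrow> f xs = 0) \<and>
     (\<forall>as bs. Suc (length as + length bs) = k \<longrightarrow> Vector_Spaces.linear scale (*) (\<lambda>x. f (as @ x # bs)))"

text \<open>Splitting a list at one entry and updating that entry describe the same slots. The split
  form suits the exchange of neighbours, the update form is the one in
  \<open>cochains\<close>.\<close>

lemma multilinear_iff:
  "multilinear k f \<longleftrightarrow> (\<forall>xs. length xs \<noteq> k \<longrightarrow> f xs = 0) \<and>
     (\<forall>xs i. length xs = k \<longrightarrow> i < k \<longrightarrow> Vector_Spaces.linear scale (*) (\<lambda>x. f (xs[i := x])))"
proof -
  have "Vector_Spaces.linear scale (*) (\<lambda>x. f (as @ x # bs))"
    if "\<forall>xs i. length xs = k \<longrightarrow> i < k \<longrightarrow> Vector_Spaces.linear scale (*) (\<lambda>x. f (xs[i := x]))"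
      "Suc (length as + length bs) = k" for as bs
    using that(1)[rule_format, of "as @ 0 # bs" "length as"] that(2) by simp
  moreover have "Vector_Spaces.linear scale (*) (\<lambda>x. f (xs[i := x]))"
    if "\<forall>as bs. Suc (length as + length bs) = k \<longrightarrow> Vector_Spaces.linear scale (*) (\<lambda>x. f (as @ x # bs))"
      "length xs = k" "i < k" for xs i
    using that(1)[rule_format, of "take i xs" "drop (Suc i) xs"] that(2,3)
    by (simp add: upd_conv_take_nth_drop)
  ultimately show ?thesis unfolding multilinear_def by blast
qed

lemma multilinear_slot:
  assumes "multilinear k f" "Suc (length as + length bs) = k"
  shows "f (as @ (x + y) # bs) = f (as @ x # bs) + f (as @ y # bs)"
    "f (as @ scale c x # bs) = c * f (as @ x # bs)"
    "f (as @ 0 # bs) = 0"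
    "f (as @ (- x) # bs) = - f (as @ x # bs)"
proof -
  show a: "f (as @ (x + y) # bs) = f (as @ x # bs) + f (as @ y # bs)"
    and s: "f (as @ scale c x # bs) = c * f (as @ x # bs)" for c x y
    using assms by (auto simp: multilinear_def linear_iff_add_scale)
  show z: "f (as @ 0 # bs) = 0" using s[of 0 0] by simp
  show "f (as @ (- x) # bs) = - f (as @ x # bs)"
    using s[of "-1" x] by simp
qed

lemma cochains_iff:
  "f \<in> cochains k \<longleftrightarrow> multilinear k f \<and> (\<forall>xs. length xs = k \<longrightarrow> \<not> distinct xs \<longrightarrow> f xs = 0)"
  unfolding cochains_def multilinear_iff by blast

text \<open>Polarization: expand the value at two adjacent entries \<open>x + y\<close>, which is
  zero. On lists of the wrong length both sides are zero.\<close>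

lemma adjacent_swap:
  assumes "multilinear k f" "\<And>as x bs. Suc (Suc (length as + length bs)) = k \<Longrightarrow> f (as @ x # x # bs) = 0"
  shows "f (as @ x # y # bs) = - f (as @ y # x # bs)"
proof (cases "Suc (Suc (length as + length bs)) = k")
  case True
  have 1: "f (as @ (u + v) # w # bs) = f (as @ u # w # bs) + f (as @ v # w # bs)" for u v w
    using multilinear_slot(1)[OF assms(1), of as "w # bs"] True by simp
  have 2: "f (as @ w # (u + v) # bs) = f (as @ w # u # bs) + f (as @ w # v # bs)" for u v w
    using multilinear_slot(1)[OF assms(1), of "as @ [w]" bs] True by simp
  have "f (as @ (x + y) # (x + y) # bs) = f (as @ x # y # bs) + f (as @ y # x # bs)"
    using assms(2)[OF True, of x] assms(2)[OF True, of y] by (simp add: 1 2)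
  with assms(2)[OF True, of "x + y"] show ?thesis by (simp add: eq_neg_iff_add_eq_0)
next
  case False
  then show ?thesis using assms(1) by (simp add: multilinear_def)
qed

lemma adjacent_move:
  assumes "multilinear k f" "\<And>as x bs. Suc (Suc (length as + length bs)) = k \<Longrightarrow> f (as @ x # x # bs) = 0"
  shows "f (ps @ x # as @ bs) = (- 1) ^ length as * f (ps @ as @ x # bs)"
proof (induction as arbitrary: ps)
  case (Cons a as)
  have "f (ps @ x # a # as @ bs) = - f (ps @ a # x # as @ bs)"
    using assms by (rule adjacent_swap)
  also have "f (ps @ a # x # as @ bs) = (- 1) ^ length as * f (ps @ a # as @ x # bs)"
    using Cons.IH[of "ps @ [a]"] by simp
  finally show ?case by simp
qed simp

text \<open>Alternation has to be checked for equal neighbours only: a repeated entry can be moved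
  next to its twin at the cost of a sign.\<close>

lemma cochainsI:
  assumes "multilinear k f" "\<And>as x bs. Suc (Suc (length as + length bs)) = k \<Longrightarrow> f (as @ x # x # bs) = 0"
  shows "f \<in> cochains k"
  unfolding cochains_iff
proof (intro conjI allI impI)
  fix xs :: "'a list" assume xs: "length xs = k" "\<not> distinct xs"
  then obtain as y bs cs where eq: "xs = as @ [y] @ bs @ [y] @ cs"
    using not_distinct_decomp by blast
  have "f xs = (- 1) ^ length bs * f (as @ bs @ y # y # cs)"
    using adjacent_move[OF assms, of as y bs "y # cs"] eq by simp
  moreover have "f ((as @ bs) @ y # y # cs) = 0"
    using xs(1) eq by (intro assms(2)) simp
  ultimately show "f xs = 0" by simp
qed fact

lemma cochains_multilinear: "f \<in> cochains k \<Longrightarrow> multilinear k f"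
  by (simp add: cochains_iff)

lemma cochains_adjacent: "f \<in> cochains k \<Longrightarrow> f (as @ x # x # bs) = 0"
  by (cases "length (as @ x # x # bs) = k") (auto simp: cochains_iff multilinear_def)

lemma cochains_length: "f \<in> cochains k \<Longrightarrow> length xs \<noteq> k \<Longrightarrow> f xs = 0"
  by (simp add: cochains_iff multilinear_def)

lemma cochains_move: "f \<in> cochains k \<Longrightarrow> f (ps @ x # as @ bs) = (- 1) ^ length as * f (ps @ as @ x # bs)"
  by (rule adjacent_move[OF cochains_multilinear cochains_adjacent])

lemma cochains_swap: "f \<in> cochains k \<Longrightarrow> f (as @ x # y # bs) = - f (as @ y # x # bs)"
  by (rule adjacent_swap[OF cochains_multilinear cochains_adjacent])

lemma cochains_contract_Suc:
  assumes "f \<in> cochains (Suc k)"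
  shows "(\<lambda>xs. f (x # xs)) \<in> cochains k"
proof (rule cochainsI)
  show "multilinear k (\<lambda>xs. f (x # xs))"
    unfolding multilinear_def
  proof (intro conjI allI impI)
    fix as bs :: "'a list" assume k: "Suc (length as + length bs) = k"
    have "\<forall>as bs. Suc (length as + length bs) = Suc k \<longrightarrow>
        Vector_Spaces.linear scale (*) (\<lambda>y. f (as @ y # bs))"
      using cochains_multilinear[OF assms] by (simp add: multilinear_def)
    from this[rule_format, of "x # as" bs] k
    show "Vector_Spaces.linear scale (*) (\<lambda>y. f (x # as @ y # bs))" by simp
  qed (use cochains_length[OF assms] in simp)
  show "f (x # as @ y # y # bs) = 0" for as y bs
    using cochains_adjacent[OF assms, of "x # as"] by simp
qed

lemma linear_set_cochains: "linear_set (cochains k)"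
proof -
  have "multilinear k (\<lambda>xs. f xs + g xs)" if "multilinear k f" "multilinear k g" for f g
    using that by (auto simp: multilinear_def linear_iff_add_scale algebra_simps)
  moreover have "multilinear k (\<lambda>xs. c * f xs)" if "multilinear k f" for c f
    using that by (auto simp: multilinear_def linear_iff_add_scale algebra_simps)
  moreover have "multilinear k (\<lambda>_. 0)" by (simp add: multilinear_def linear_iff_add_scale)
  ultimately show ?thesis by (auto simp: linear_set_def cochains_iff)
qed

lemma linear_map_on_differential: "linear_map_on C differential"
  unfolding linear_map_on_def differential_def case_prod_unfold
  by (simp add: fun_eq_iff sum.distrib sum_distrib_left distrib_left mult.left_commute)

section \<open>The differential maps cochains to cochains\<close>

lemma bracket_simps [simp]:
  "bracket (x + y) z = bracket x z + bracket y z" "bracket x (y + z) = bracket x y + bracket x z"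
  "bracket (scale c x) y = scale c (bracket x y)" "bracket x (scale c y) = scale c (bracket x y)"
  using bracket_linear_left bracket_linear_right by (auto simp: Vector_Spaces.linear_iff)

lemma bracket_antisym: "bracket x y = - bracket y x"
proof -
  have "bracket (x + y) (x + y) = (bracket x x + bracket x y) + (bracket y x + bracket y y)"
    by (simp add: add_ac)
  then have "bracket x y + bracket y x = 0" by (simp add: bracket_self)
  then show ?thesis by (simp add: eq_neg_iff_add_eq_0)
qed

abbreviation position_pairs :: "nat \<Rightarrow> (nat \<times> nat) set" where
  "position_pairs m \<equiv> {(i, j). i < j \<and> j < m}"

lemma finite_position_pairs [simp]: "finite (position_pairs m)"
  by (rule finite_subset[of _ "{..<m} \<times> {..<m}"]) auto

text \<open>Each pair of positions is treated separately: a given entry goes either into the bracket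
  or into the remaining list, never into both, so every term is linear in it.\<close>

lemma multilinear_differential:
  assumes "f \<in> cochains k"
  shows "multilinear (Suc k) (differential f)"
  unfolding multilinear_def
proof (intro conjI allI impI)
  fix xs :: "'a list" assume "length xs \<noteq> Suc k"
  then show "differential f xs = 0"
    unfolding differential_def
    by (intro sum.neutral ballI) (auto simp: length_nths_delete2 cochains_length[OF assms])
next
  fix as bs :: "'a list" assume len: "Suc (length as + length bs) = Suc k"
  let ?p = "length as"
  let ?xs = "\<lambda>x. as @ x # bs"
  let ?t = "\<lambda>(i, j) x. f (bracket (?xs x ! i) (?xs x ! j) # nths (?xs x) (- {i, j}))"
  have lin: "Vector_Spaces.linear scale (*) (?t (i, j))" if ij: "i < j" "j < length (?xs 0)" for i j
  proof -
    define us where "us = nths as (- {i, j})"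
    define vs where "vs = nths bs {l. Suc (l + ?p) \<in> - {i, j}}"
    have nths: "nths (?xs x) (- {i, j}) = us @ (if ?p \<in> {i, j} then [] else [x]) @ vs" for x
      by (auto simp: nths_append_Cons us_def vs_def)
    have len': "length (us @ (if ?p \<in> {i, j} then [] else [0]) @ vs) = k - 1"
      unfolding nths[symmetric] using ij len by (simp add: length_nths_delete2)
    have k: "k \<ge> 1" using ij len by simp
    \<comment> \<open>The entries away from position \<open>?p\<close> do not depend on
      \<open>x\<close>, so they may be read off with \<open>0\<close> in that place.\<close>
    define y where "y = (\<lambda>l. ?xs 0 ! l)"
    have nth: "?xs x ! l = y l" if "l \<noteq> ?p" for l x
      using that by (simp add: nth_append nth_Cons' y_def)
    note slot = multilinear_slot(1,2)[OF cochains_multilinear[OF assms], of "[]", simplified]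
    consider "i = ?p" | "j = ?p" | "?p \<notin> {i, j}" by blast
    then show ?thesis
    proof cases
      case 1
      then have "?t (i, j) = (\<lambda>x. f (bracket x (y j) # us @ vs))"
        using nth[of j] ij 1 nths by (simp add: fun_eq_iff)
      then show ?thesis
        using slot[of "us @ vs"] len' 1 k by (simp add: linear_iff_add_scale)
    next
      case 2
      then have "?t (i, j) = (\<lambda>x. f (bracket (y i) x # us @ vs))"
        using nth[of i] ij 2 nths by (simp add: fun_eq_iff)
      then show ?thesis
        using slot[of "us @ vs"] len' 2 k by (simp add: linear_iff_add_scale)
    next
      case 3
      then have "?t (i, j) = (\<lambda>x. f (bracket (y i) (y j) # us @ x # vs))"
        using nth[of i] nth[of j] by (simp add: nths fun_eq_iff)
      then show ?thesis
        using multilinear_slot(1,2)[OF cochains_multilinear[OF assms],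
            of "bracket (y i) (y j) # us" vs] len' 3 k
        by (simp add: linear_iff_add_scale)
    qed
  qed
  have "differential f (?xs x) = (\<Sum>p\<in>position_pairs (Suc k). (- 1) ^ (fst p + snd p) * ?t p x)" for x
    using len by (auto simp: differential_def intro!: sum.cong)
  then show "Vector_Spaces.linear scale (*) (\<lambda>x. differential f (?xs x))"
    using lin len by (simp only:) (rule linear_sum, auto)
qed

text \<open>
  If \<open>x\<close> stands at the positions \<open>p\<close> and \<open>p + 1\<close>, the terms of pairs \<open>{i, p}\<close> and \<open>{i, p + 1}\<close> agree
  up to sign; this is why only adjacent entries are compared.
\<close>
lemma differential_cochains:
  assumes "f \<in> cochains k"
  shows "differential f \<in> cochains (Suc k)"
proof (rule cochainsI[OF multilinear_differential[OF assms]])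
  fix as bs :: "'a list" and x
  let ?xs = "as @ x # x # bs" and ?p = "length as"
  let ?q = "Suc ?p"
  let ?P = "position_pairs (length ?xs)"
  let ?t = "\<lambda>(i, j). (- 1) ^ (i + j) * f (bracket (?xs ! i) (?xs ! j) # nths ?xs (- {i, j}))"
  \<comment> \<open>The pairs that contain exactly one of the two positions of \<open>x\<close> form
    \<open>?A\<close> and \<open>?B\<close>; they cancel each other.\<close>
  let ?A = "{(i, j) \<in> ?P. ?p \<in> {i, j} \<and> ?q \<notin> {i, j}}"
  let ?B = "{(i, j) \<in> ?P. ?q \<in> {i, j} \<and> ?p \<notin> {i, j}}"
  have nths: "nths ?xs (- {i, j}) = nths as (- {i, j}) @ (if ?p \<in> {i, j} then [] else [x]) @
      (if ?q \<in> {i, j} then [] else [x]) @ nths bs {l. Suc (Suc (l + ?p)) \<in> - {i, j}}" for i j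
    by (auto simp: nths_append_Cons nths_Cons)
  have nth [simp]: "?xs ! ?p = x" "?xs ! ?q = x"
    by (simp_all add: nth_append)
  \<comment> \<open>Exchanging the neighbouring positions \<open>?p\<close> and \<open>?q\<close>
    keeps i < j, leaves the bracket and the remaining list unchanged and changes i + j by one, hence
    the sign.\<close>
  have "sum ?t ?B = sum (\<lambda>p. - ?t p) ?A"
  proof (rule sum.reindex_bij_witness[where
        i = "\<lambda>(i, j). (if i = ?p then ?q else i, if j = ?p then ?q else j)" and
        j = "\<lambda>(i, j). (if i = ?q then ?p else i, if j = ?q then ?p else j)"])
    fix a assume "a \<in> ?B"
    then obtain i j where a: "a = (i, j)" "i < j" "j < length ?xs" "?q \<in> {i, j}" "?p \<notin> {i, j}"
      by auto
    have us: "nths as (- {?p, l}) = nths as (- {?q, l})" "nths as (- {l, ?p}) = nths as (- {l, ?q})" for l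
      by (intro nths_cong; auto)+
    show "- ?t (case a of (i, j) \<Rightarrow> (if i = ?q then ?p else i, if j = ?q then ?p else j)) = ?t a"
      using a(2-) by (auto simp: a(1) nths us)
  qed (auto split: if_splits)
  \<comment> \<open>The remaining pairs contain both positions, which gives the bracket of
    \<open>x\<close> with itself, or neither, which leaves two equal neighbours in the list.\<close>
  moreover have "?t a = 0" if "a \<in> ?P - ?A - ?B" for a
  proof -
    obtain i j where "a = (i, j)" by fastforce
    then have a: "a = (i, j)" "i < j" "j < length ?xs" using that by simp_all
    show ?thesis
    proof (cases "?p \<in> {i, j}")
      case True
      with that a have "i = ?p" "j = ?q" by auto
      then have "bracket (?xs ! i) (?xs ! j) = 0" using nth bracket_self by simp
      then have "f (bracket (?xs ! i) (?xs ! j) # nths ?xs (- {i, j})) = 0"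
      proof (cases "length ?xs = Suc k")
        case True
        then have "Suc (length (nths ?xs (- {i, j}))) = k"
          using a length_nths_delete2[OF a(2,3)] by simp
        then show ?thesis
          using multilinear_slot(3)[OF cochains_multilinear[OF assms], of "[]" "nths ?xs (- {i, j})"]
          \<open>bracket _ _ = 0\<close> by simp
      next
        case False
        then show ?thesis using a length_nths_delete2[OF a(2,3)] by (intro cochains_length[OF assms]) auto
      qed
      then show ?thesis by (simp add: a(1))
    next
      case False
      with that a have "?q \<notin> {i, j}" by auto
      then show ?thesis
        using False cochains_adjacent[OF assms, of "bracket (?xs ! i) (?xs ! j) # nths as (- {i, j})"]
        by (simp add: a(1) nths)
    qed
  qed
  then have "sum ?t (?P - ?A - ?B) = 0" by (intro sum.neutral) blast
  moreover have "sum ?t ?P = sum ?t ?A + (sum ?t ?B + sum ?t (?P - ?A - ?B))"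
  proof -
    have "sum ?t ?P = sum ?t (?P - ?A) + sum ?t ?A"
      by (rule sum.subset_diff) auto
    moreover have "sum ?t (?P - ?A) = sum ?t (?P - ?A - ?B) + sum ?t ?B"
      by (rule sum.subset_diff) auto
    ultimately show ?thesis by simp
  qed
  ultimately show "differential f ?xs = 0"
    by (simp add: differential_def sum_negf)
qed

text \<open>Cartan's formula for the contraction of a differential.\<close>
lemma differential_Cons_exact:
  assumes "f \<in> cochains (length xs)"
  shows "differential f (x # xs) =
    - (\<Sum>j<length xs. f (xs[j := bracket x (xs ! j)])) - differential (\<lambda>ys. f (x # ys)) xs"
proof -
  let ?m = "length xs"
  let ?t = "\<lambda>(i, j). (- 1) ^ (i + j) * f (bracket ((x # xs) ! i) ((x # xs) ! j) # nths (x # xs) (- {i, j}))"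
  \<comment> \<open>\<open>?A\<close> collects the brackets with \<open>x\<close>. \<open>?B\<close>
    consists of the pairs of \<open>xs\<close> with both positions shifted by one, which keeps the
    parity of i + j; its sign comes from moving \<open>x\<close> in front of the bracket.\<close>
  let ?A = "(\<lambda>j. (0, Suc j)) ` {..<?m}" and ?B = "map_prod Suc Suc ` position_pairs ?m"
  have P: "position_pairs (Suc ?m) = ?A \<union> ?B"
    by (auto simp: image_iff less_Suc_eq_0_disj) 
  have "sum ?t ?A = (\<Sum>j<?m. - f (xs[j := bracket x (xs ! j)]))"
  proof (subst sum.reindex, simp add: inj_on_def, intro sum.cong refl)
    fix j assume "j \<in> {..<?m}"
    then have j: "j < ?m" by simp
    have "{i. Suc i \<noteq> Suc j} = - {j}" by auto
    then have "nths (x # xs) (- {0, Suc j}) = take j xs @ drop (Suc j) xs"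
      using nths_delete1[OF j] by (simp add: nths_Cons)
    \<comment> \<open>Putting the bracket back at position \<open>j\<close> costs the sign of
      \<open>j\<close> exchanges, which combines with the exponent \<open>0 + Suc j\<close> to
      -1.\<close>
    moreover have "f (b # take j xs @ drop (Suc j) xs) = (- 1) ^ j * f (xs[j := b])" for b
      using cochains_move[OF assms, of "[]" b "take j xs" "drop (Suc j) xs"] j
      by (simp add: upd_conv_take_nth_drop min_def)
    ultimately show "(?t \<circ> (\<lambda>j. (0, Suc j))) j = - f (xs[j := bracket x (xs ! j)])"
      by (simp add: power_add[symmetric] mult.assoc[symmetric])
  qed
  moreover have "sum ?t ?B = - differential (\<lambda>ys. f (x # ys)) xs"
  proof (subst sum.reindex, simp add: inj_on_def, unfold differential_def sum_negf[symmetric], intro sum.cong refl)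
    fix p assume "p \<in> position_pairs ?m"
    then obtain i j where p: "p = (i, j)" by auto
    have "{l. Suc l \<noteq> Suc i \<and> Suc l \<noteq> Suc j} = - {i, j}" by auto
    then have "nths (x # xs) (- {Suc i, Suc j}) = x # nths xs (- {i, j})"
      by (simp add: nths_Cons)
    then show "(?t \<circ> map_prod Suc Suc) p =
      - (case p of (i, j) \<Rightarrow> (- 1) ^ (i + j) * f (x # bracket (xs ! i) (xs ! j) # nths xs (- {i, j})))"
      using cochains_swap[OF assms, of "[]" "bracket (xs ! i) (xs ! j)" x "nths xs (- {i, j})"]
      by (simp add: p)
  qed
  moreover have "sum ?t (?A \<union> ?B) = sum ?t ?A + sum ?t ?B"
    by (rule sum.union_disjoint) auto
  ultimately show ?thesis
    unfolding differential_def by (simp add: P sum_negf)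
qed

section \<open>Testing cochains on a spanning set\<close>

text \<open>Only vanishing is transported, so no sign of a permutation has to be tracked: the first
  entry of one list is moved to the front of the other and contracted away.\<close>

lemma cochains_permute:
  assumes "f \<in> cochains k" "mset xs = mset ys" "f xs = 0"
  shows "f ys = 0"
  using assms
proof (induction xs arbitrary: ys f k)
  case (Cons x xs)
  have "x \<in> set ys" using Cons.prems(2) by (metis list.set_intros(1) set_mset_mset)
  then obtain as bs where ys: "ys = as @ x # bs" by (meson split_list)
  show ?case
  proof (cases k)
    case 0
    then show ?thesis using ys cochains_length[OF Cons.prems(1)] by simp
  next
    case (Suc l)
    have "f (x # as @ bs) = 0"
      using Cons.IH[of "\<lambda>xs. f (x # xs)" l "as @ bs"] cochains_contract_Suc[of f l x] Cons.prems Suc ys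
      by simp
    then show ?thesis using cochains_move[OF Cons.prems(1), of "[]" x as bs] ys by simp
  qed
qed simp

text \<open>The entries are expanded in \<open>B\<close> one at a time from right to left;
  \<open>xs\<close> is the part that already lies in \<open>B\<close>. Lists in \<open>B\<close>
  with repetitions are covered by alternation.\<close>

lemma cochain_eq_0_on_spanning_set:
  assumes "f \<in> cochains k" "span B = UNIV"
    and "\<And>xs. set xs \<subseteq> B \<Longrightarrow> distinct xs \<Longrightarrow> length xs = k \<Longrightarrow> f xs = 0"
  shows "f = (\<lambda>_. 0)"
proof -
  have "f (ys @ xs) = 0" if "set xs \<subseteq> B" for xs ys
    using that
  proof (induction ys arbitrary: xs rule: rev_induct)
    case Nil
    then show ?case
      using assms(3)[of xs] assms(1) by (cases "length xs = k \<and> distinct xs") (auto simp: cochains_iff multilinear_def)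
  next
    case (snoc y ys)
    show ?case
    proof (cases "Suc (length ys + length xs) = k")
      case True
      note slot = multilinear_slot[OF cochains_multilinear[OF assms(1)] True]
      have "y \<in> span B" using assms(2) by simp
      then have "f (ys @ y # xs) = 0"
      proof (induction rule: span_induct_alt)
        case base
        show ?case by (rule slot(3))
      next
        case (step c x y)
        then show ?case using snoc.IH[of "x # xs"] snoc.prems slot(1,2) by simp
      qed
      then show ?thesis by simp
    next
      case False
      then show ?thesis by (simp add: cochains_length[OF assms(1)])
    qed
  qed
  from this[of "[]"] show ?thesis by auto
qed

text \<open>For \<open>k = 0\<close> the contraction is the zero function, which is a cochain in
  every degree, so truncated subtraction does no harm.\<close>

lemma cochains_contract:
  assumes "f \<in> cochains k"
  shows "(\<lambda>xs. f (x # xs)) \<in> cochains (k - 1)"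
proof (cases k)
  case 0
  then have "(\<lambda>xs. f (x # xs)) = (\<lambda>_. 0)" using cochains_length[OF assms] by auto
  then show ?thesis using linear_setD(1)[OF linear_set_cochains] by simp
qed (use assms cochains_contract_Suc in simp)

text \<open>On lists of the wrong length every term of Cartan's formula vanishes, so it holds for
  all lists.\<close>

lemma differential_Cons:
  assumes f: "f \<in> cochains k"
  shows "differential f (x # xs) =
    - (\<Sum>j<length xs. f (xs[j := bracket x (xs ! j)])) - differential (\<lambda>ys. f (x # ys)) xs"
proof (cases "length xs = k")
  case False
  have "differential (\<lambda>ys. f (x # ys)) xs = 0"
  proof (cases k)
    case 0
    then have "(\<lambda>ys. f (x # ys)) = (\<lambda>_. 0)" using cochains_length[OF f] by auto
    then show ?thesis by (simp add: differential_def)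
  next
    case (Suc l)
    then show ?thesis
      using cochains_length[OF differential_cochains[OF cochains_contract_Suc[of f l x]]] f False by simp
  qed
  then show ?thesis
    using False cochains_length[OF f] cochains_length[OF differential_cochains[OF f]] by simp
qed (use assms differential_Cons_exact in simp)

lemma cochains_slot:
  assumes "f \<in> cochains k"
  shows "f (as @ 0 # bs) = 0" "f (as @ (- x) # bs) = - f (as @ x # bs)"
proof -
  show "f (as @ 0 # bs) = 0"
    by (cases "Suc (length as + length bs) = k")
       (simp_all add: multilinear_slot[OF cochains_multilinear[OF assms]] cochains_length[OF assms])
  show "f (as @ (- x) # bs) = - f (as @ x # bs)"
    by (cases "Suc (length as + length bs) = k")
       (simp_all add: multilinear_slot[OF cochains_multilinear[OF assms]] cochains_length[OF assms])
qed

lemma cochains_update: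
  assumes "f \<in> cochains k" "j < length xs"
  shows "f (xs[j := 0]) = 0" "f (xs[j := - y]) = - f (xs[j := y])"
  using assms(2) by (simp_all add: upd_conv_take_nth_drop cochains_slot[OF assms(1)])

text \<open>Every bracket with \<open>x\<close> puts a zero entry into \<open>f\<close>, so only the
  contracted term of Cartan's formula survives.\<close>

lemma differential_Cons_commuting:
  assumes "f \<in> cochains k" "\<And>y. y \<in> set xs \<Longrightarrow> bracket x y = 0"
  shows "differential f (x # xs) = - differential (\<lambda>ys. f (x # ys)) xs"
  using assms by (simp add: differential_Cons cochains_update)

end

section \<open>Bases of the spaces of cochains\<close>

lemma linear_set_sum:
  assumes "linear_set C" "finite I" "\<And>i. i \<in> I \<Longrightarrow> f i \<in> C"
  shows "(\<lambda>x. \<Sum>i\<in>I. f i x) \<in> C"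
  using assms(2,3)
proof (induction I rule: finite_induct)
  case (insert i I)
  then show ?case using linear_setD(2)[OF assms(1), of "f i" "\<lambda>x. \<Sum>i\<in>I. f i x"] by simp
qed (simp add: linear_setD(1)[OF assms(1)])

context lie_algebra
begin

definition basis_matrix :: "'a set \<Rightarrow> 'a list \<Rightarrow> 'a list \<Rightarrow> 'k mat" where
  "basis_matrix B bs xs =
     mat (length bs) (length bs) (\<lambda>(i, j). representation B (xs ! i) (bs ! j))"

text \<open>The wedge product of the dual basis vectors of \<open>bs\<close>, written as a
  determinant of coordinates.\<close>

definition elementary_cochain :: "'a set \<Rightarrow> 'a list \<Rightarrow> 'a list \<Rightarrow> 'k" where
  "elementary_cochain B bs xs = (if length xs = length bs then det (basis_matrix B bs xs) else 0)"

lemma basis_matrix_carrier [simp]: "basis_matrix B bs xs \<in> carrier_mat (length bs) (length bs)"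
  by (simp add: basis_matrix_def)

lemma linear_representation:
  assumes "independent B" "span B = UNIV"
  shows "Vector_Spaces.linear scale (*) (\<lambda>x. representation B x b)"
  using assms by (simp add: linear_iff_add_scale representation_add representation_scale)

text \<open>Laplace expansion along the row of the varying entry gives linearity, since the
  cofactors do not involve that row. Equal entries give equal rows.\<close>

lemma elementary_cochain_in_cochains:
  assumes B: "independent B" "span B = UNIV"
  shows "elementary_cochain B bs \<in> cochains (length bs)"
proof -
  let ?k = "length bs"
  have lin: "Vector_Spaces.linear scale (*) (\<lambda>x. elementary_cochain B bs (as @ x # cs))"
    if len: "Suc (length as + length cs) = ?k" for as cs
  proof -
    let ?p = "length as" and ?M = "\<lambda>x. basis_matrix B bs (as @ x # cs)"
    have p: "?p < ?k" using len by simp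
    have cof: "cofactor (?M x) ?p j = cofactor (?M 0) ?p j" for x j
    proof -
      have "mat_delete (?M x) ?p j = mat_delete (?M 0) ?p j"
        unfolding mat_delete_def basis_matrix_def
        by (rule eq_matI) (auto simp: nth_append nth_Cons')
      then show ?thesis by (simp add: cofactor_def)
    qed
    have "elementary_cochain B bs (as @ x # cs) =
        (\<Sum>j\<in>{..<?k}. cofactor (?M 0) ?p j * representation B x (bs ! j))" for x
    proof -
      have "elementary_cochain B bs (as @ x # cs) = det (?M x)"
        using len by (simp add: elementary_cochain_def)
      also have "\<dots> = (\<Sum>j<?k. ?M x $$ (?p, j) * cofactor (?M x) ?p j)"
        by (rule laplace_expansion_row[OF basis_matrix_carrier p])
      also have "\<dots> = (\<Sum>j\<in>{..<?k}. cofactor (?M 0) ?p j * representation B x (bs ! j))"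
        using p by (intro sum.cong) (simp_all add: cof[of x], simp add: basis_matrix_def)
      finally show ?thesis .
    qed
    then show ?thesis
      by (simp only:) (rule linear_sum, rule linear_representation[OF B])
  qed
  show ?thesis
    unfolding cochains_iff multilinear_def
  proof (intro conjI allI impI lin)
    fix xs :: "'a list" assume xs: "length xs = ?k" "\<not> distinct xs"
    then obtain i j where ij: "i < ?k" "j < ?k" "i \<noteq> j" "xs ! i = xs ! j"
      by (auto simp: distinct_conv_nth)
    have "det (basis_matrix B bs xs) = 0"
      by (rule det_identical_rows[OF basis_matrix_carrier ij(3,1,2)])
         (use ij in \<open>auto simp: basis_matrix_def row_def\<close>)
    then show "elementary_cochain B bs xs = 0" by (simp add: elementary_cochain_def)
  qed (simp add: elementary_cochain_def)
qed

text \<open>On \<open>bs\<close> the matrix is the identity. If the sets differ, their equal size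
  yields an entry of \<open>cs\<close> outside \<open>bs\<close>, whose row is zero.\<close>

lemma elementary_cochain_basis:
  assumes B: "independent B" and bs: "set bs \<subseteq> B" "distinct bs"
    and cs: "set cs \<subseteq> B" "distinct cs" "length cs = length bs"
  shows "elementary_cochain B bs bs = 1" "set cs \<noteq> set bs \<Longrightarrow> elementary_cochain B bs cs = 0"
proof -
  have "basis_matrix B bs bs = 1\<^sub>m (length bs)"
    using bs nth_mem[of _ bs]
    by (intro eq_matI)
       (auto simp: basis_matrix_def representation_basis[OF B] nth_eq_iff_index_eq subset_iff)
  then show "elementary_cochain B bs bs = 1" by (simp add: elementary_cochain_def)
next
  assume "set cs \<noteq> set bs"
  moreover have "card (set cs) = card (set bs)" using bs cs by (simp add: distinct_card)
  ultimately obtain c where "c \<in> set cs" "c \<notin> set bs"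
    using card_subset_eq[of "set bs" "set cs"] by auto
  then obtain p where p: "p < length bs" "cs ! p \<notin> set bs" "cs ! p \<in> B"
    using cs by (metis in_set_conv_nth subsetD)
  have "det (basis_matrix B bs cs) = (\<Sum>j<length bs. basis_matrix B bs cs $$ (p, j) * cofactor (basis_matrix B bs cs) p j)"
    by (rule laplace_expansion_row[OF basis_matrix_carrier p(1)])
  also have "\<dots> = 0"
  proof (intro sum.neutral ballI)
    fix j assume "j \<in> {..<length bs}"
    then have "j < length bs" by simp
    moreover from this have "bs ! j \<noteq> cs ! p" using p(2) nth_mem by metis
    ultimately show "basis_matrix B bs cs $$ (p, j) * cofactor (basis_matrix B bs cs) p j = 0"
      using p by (simp add: basis_matrix_def representation_basis[OF B])
  qed
  finally show "elementary_cochain B bs cs = 0" by (simp add: elementary_cochain_def)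
qed

text \<open>\<open>l\<close> chooses one ordering for each of a family of \<open>k\<close>-subsets
  of \<open>B\<close>. The elementary cochains of these lists are dual to evaluation at them, so
  values there can be prescribed; if every \<open>k\<close>-subset occurs, the values also determine
  the cochain.\<close>

lemma cochain_basis:
  assumes B: "independent B" "span B = UNIV" and I: "finite I"
    and l: "\<And>s. s \<in> I \<Longrightarrow> set (l s) \<subseteq> B \<and> distinct (l s) \<and> length (l s) = k"
    and inj: "inj_on (\<lambda>s. set (l s)) I"
  shows cochain_extension: "\<exists>f\<in>cochains k. \<forall>s\<in>I. f (l s) = g s"
    and "\<lbrakk>\<And>xs. set xs \<subseteq> B \<Longrightarrow> distinct xs \<Longrightarrow> length xs = k \<Longrightarrow> \<exists>s\<in>I. set (l s) = set xs\<rbrakk>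
      \<Longrightarrow> fdim (cochains k) = card I \<and> finite_dim (cochains k)"
proof -
  define E where "E = (\<lambda>g xs. \<Sum>s\<in>I. g s * elementary_cochain B (l s) xs)"
  have E: "E g \<in> cochains k" for g
    unfolding E_def
  proof (rule linear_set_sum[OF linear_set_cochains I])
    fix s assume "s \<in> I"
    then show "(\<lambda>xs. g s * elementary_cochain B (l s) xs) \<in> cochains k"
      using linear_setD(3)[OF linear_set_cochains elementary_cochain_in_cochains[OF B]] l by metis
  qed
  have E_l: "E g (l s) = g s" if "s \<in> I" for g s
  proof -
    have "E g (l s) = (\<Sum>t\<in>I. if t = s then g t else 0)"
      unfolding E_def
    proof (intro sum.cong refl)
      fix t assume t: "t \<in> I"
      have "set (l s) \<noteq> set (l t)" if "t \<noteq> s"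
        using inj that t \<open>s \<in> I\<close> by (auto simp: inj_on_def)
      then show "g t * elementary_cochain B (l t) (l s) = (if t = s then g t else 0)"
        using elementary_cochain_basis[OF B(1), of "l t" "l s"] l[OF t] l[OF \<open>s \<in> I\<close>] by auto
    qed
    then show ?thesis using that I by simp
  qed
  show "\<exists>f\<in>cochains k. \<forall>s\<in>I. f (l s) = g s" using E E_l by blast
  assume all: "\<And>xs. set xs \<subseteq> B \<Longrightarrow> distinct xs \<Longrightarrow> length xs = k \<Longrightarrow> \<exists>s\<in>I. set (l s) = set xs"
  have uniq: "f = (\<lambda>_. 0)" if f: "f \<in> cochains k" "\<And>s. s \<in> I \<Longrightarrow> f (l s) = 0" for f
  proof (rule cochain_eq_0_on_spanning_set[OF f(1) B(2)])
    fix xs :: "'a list" assume xs: "set xs \<subseteq> B" "distinct xs" "length xs = k"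
    then obtain s where s: "s \<in> I" "set (l s) = set xs" using all by blast
    then have "mset (l s) = mset xs" using l xs by (simp add: set_eq_iff_mset_eq_distinct)
    then show "f xs = 0" using cochains_permute[OF f(1)] f(2)[OF s(1)] by blast
  qed
  let ?C = "supported_on I :: ('b \<Rightarrow> 'k) set"
  have lin: "linear_map_on ?C E"
    by (simp add: linear_map_on_def E_def fun_eq_iff distrib_right sum.distrib sum_distrib_left mult.assoc)
  have image: "E ` ?C = cochains k"
  proof (intro equalityI subsetI)
    fix f assume f: "f \<in> cochains k"
    let ?g = "\<lambda>s. if s \<in> I then f (l s) else 0"
    \<comment> \<open>\<open>f\<close> and the cochain built from its own values agree on all lists
      \<open>l s\<close>, hence everywhere.\<close>
    have "(\<lambda>xs. f xs + - 1 * E ?g xs) = (\<lambda>_. 0)"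
      by (intro uniq linear_setD(2)[OF linear_set_cochains f] linear_setD(3)[OF linear_set_cochains E])
         (simp add: E_l)
    then have "f = E ?g" by (simp add: fun_eq_iff)
    then show "f \<in> E ` ?C" by (rule image_eqI[where x = ?g]) (simp add: supported_on_def)
  qed (use E in auto)
  have "{g \<in> ?C. E g = (\<lambda>_. 0)} = supported_on {}"
  proof (intro equalityI subsetI)
    fix g assume g: "g \<in> {g \<in> ?C. E g = (\<lambda>_. 0)}"
    have "g s = 0" for s
      using g E_l[of s g] by (cases "s \<in> I") (auto simp: supported_on_def)
    then show "g \<in> supported_on {}" by (simp add: supported_on_def)
  qed (auto simp: supported_on_def E_def)
  then show "fdim (cochains k) = card I \<and> finite_dim (cochains k)"
    using fdim_rank_nullity[OF linear_set_supported_on lin] I image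
    by (simp add: fdim_supported_on)
qed

end

section \<open>The Lefschetz operator\<close>

text \<open>
  A pair \<open>(P, Q)\<close> stands for the exterior monomial with factors \<open>x\<^sub>i\<close>, \<open>i \<in> P\<close>, and \<open>y\<^sub>i\<close>, \<open>i \<in> Q\<close>. If the
  factors are ordered by index, then multiplication by \<open>\<Sum> x\<^sub>i y\<^sub>i\<close> involves no signs.
\<close>
definition lefschetz :: "('i set \<times> 'i set \<Rightarrow> complex) \<Rightarrow> 'i set \<times> 'i set \<Rightarrow> complex" where
  "lefschetz g = (\<lambda>(P, Q). \<Sum>i\<in>P \<inter> Q. g (P - {i}, Q - {i}))"

definition lefschetz_adjoint :: "'i set \<Rightarrow> ('i set \<times> 'i set \<Rightarrow> complex) \<Rightarrow> 'i set \<times> 'i set \<Rightarrow> complex" where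
  "lefschetz_adjoint U g = (\<lambda>(P, Q). \<Sum>i\<in>U - (P \<union> Q). g (insert i P, insert i Q))"

lemma lefschetz_add: "lefschetz (\<lambda>x. f x + g x) = (\<lambda>x. lefschetz f x + lefschetz g x)"
  and lefschetz_scale: "lefschetz (\<lambda>x. c * f x) = (\<lambda>x. c * lefschetz f x)"
  by (auto simp: lefschetz_def fun_eq_iff sum.distrib sum_distrib_left)

lemma lefschetz_adjoint_add:
    "lefschetz_adjoint U (\<lambda>x. f x + g x) = (\<lambda>x. lefschetz_adjoint U f x + lefschetz_adjoint U g x)"
  and lefschetz_adjoint_scale:
    "lefschetz_adjoint U (\<lambda>x. c * f x) = (\<lambda>x. c * lefschetz_adjoint U f x)"
  by (auto simp: lefschetz_adjoint_def fun_eq_iff sum.distrib sum_distrib_left)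

abbreviation set_pairs :: "'i set \<Rightarrow> ('i set \<times> 'i set) set" where
  "set_pairs U \<equiv> Pow U \<times> Pow U"

text \<open>Both sides are sums over a monomial and an index. Removing the index from both sets
  matches indices lying in both sets with indices lying in neither. The pairing is bilinear, without
  conjugation.\<close>

lemma lefschetz_adjointness:
  assumes U: "finite U"
  shows "(\<Sum>x\<in>set_pairs U. lefschetz g x * h x) = (\<Sum>x\<in>set_pairs U. g x * lefschetz_adjoint U h x)"
proof -
  have fin: "finite (set_pairs U)" using U by simp
  have finP: "finite (fst x \<inter> snd x)" "finite (U - (fst x \<union> snd x))" if "x \<in> set_pairs U" for x
    using that by (auto intro!: finite_subset[OF _ U])
  have "(\<Sum>x\<in>set_pairs U. lefschetz g x * h x) =
      (\<Sum>(x, i)\<in>Sigma (set_pairs U) (\<lambda>x. fst x \<inter> snd x). g (fst x - {i}, snd x - {i}) * h x)"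
    using sum.Sigma[OF fin, of "\<lambda>x. fst x \<inter> snd x" "\<lambda>x i. g (fst x - {i}, snd x - {i}) * h x"] finP
    by (simp add: lefschetz_def case_prod_unfold sum_distrib_right)
  also have "\<dots> = (\<Sum>(x, i)\<in>Sigma (set_pairs U) (\<lambda>x. U - (fst x \<union> snd x)). g x * h (insert i (fst x), insert i (snd x)))"
    by (rule sum.reindex_bij_witness[where
          i = "\<lambda>(x, i). ((insert i (fst x), insert i (snd x)), i)" and
          j = "\<lambda>(x, i). ((fst x - {i}, snd x - {i}), i)"])
       (auto simp: insert_absorb)
  also have "\<dots> = (\<Sum>x\<in>set_pairs U. g x * lefschetz_adjoint U h x)"
    using sum.Sigma[OF fin, of "\<lambda>x. U - (fst x \<union> snd x)" "\<lambda>x i. g x * h (insert i (fst x), insert i (snd x))"] finP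
    by (simp add: lefschetz_adjoint_def case_prod_unfold sum_distrib_left)
  finally show ?thesis .
qed

text \<open>The \<open>sl_2\<close> relation. The terms that add one index and remove a different
  one agree in both orders. The terms that add and remove the same index are counted by
  \<open>U - (P \<union> Q)\<close> and by \<open>P \<inter> Q\<close>, and these cardinalities
  differ by the stated factor.\<close>

lemma lefschetz_commutator:
  assumes U: "finite U" and x: "(P, Q) \<in> set_pairs U"
  shows "lefschetz_adjoint U (lefschetz g) (P, Q) =
    lefschetz (lefschetz_adjoint U g) (P, Q) + (of_nat (card U) - of_nat (card P) - of_nat (card Q)) * g (P, Q)"
proof -
  have fin: "finite P" "finite Q" using x U by (auto intro: finite_subset)
  let ?N = "U - (P \<union> Q)" and ?D = "P \<inter> Q"
  let ?s = "\<lambda>i l. g (insert i P - {l}, insert i Q - {l})"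
  have "lefschetz_adjoint U (lefschetz g) (P, Q) = (\<Sum>i\<in>?N. g (P, Q) + (\<Sum>l\<in>?D. ?s i l))"
    unfolding lefschetz_adjoint_def lefschetz_def prod.case
  proof (intro sum.cong refl)
    fix i assume i: "i \<in> ?N"
    then have "insert i P \<inter> insert i Q = insert i ?D" "insert i P - {i} = P" "insert i Q - {i} = Q" by auto
    then show "(\<Sum>l\<in>insert i P \<inter> insert i Q. ?s i l) = g (P, Q) + (\<Sum>l\<in>?D. ?s i l)"
      using i fin by simp
  qed
  also have "\<dots> = of_nat (card ?N) * g (P, Q) + (\<Sum>i\<in>?N. \<Sum>l\<in>?D. ?s i l)"
    by (simp add: sum.distrib)
  finally have 1: "lefschetz_adjoint U (lefschetz g) (P, Q) = of_nat (card ?N) * g (P, Q) + (\<Sum>i\<in>?N. \<Sum>l\<in>?D. ?s i l)" .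
  have "lefschetz (lefschetz_adjoint U g) (P, Q) = (\<Sum>l\<in>?D. g (P, Q) + (\<Sum>i\<in>?N. ?s i l))"
    unfolding lefschetz_adjoint_def lefschetz_def prod.case
  proof (intro sum.cong refl)
    fix l assume l: "l \<in> ?D"
    then have eq: "U - (P - {l} \<union> (Q - {l})) = insert l ?N" "insert l (P - {l}) = P" "insert l (Q - {l}) = Q"
      using x by auto
    have "(\<Sum>i\<in>?N. g (insert i (P - {l}), insert i (Q - {l}))) = (\<Sum>i\<in>?N. ?s i l)"
    proof (intro sum.cong refl)
      fix i assume "i \<in> ?N"
      then have "insert i (P - {l}) = insert i P - {l}" "insert i (Q - {l}) = insert i Q - {l}" using l by auto
      then show "g (insert i (P - {l}), insert i (Q - {l})) = ?s i l" by simp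
    qed
    then show "(\<Sum>i\<in>U - (P - {l} \<union> (Q - {l})). g (insert i (P - {l}), insert i (Q - {l}))) = g (P, Q) + (\<Sum>i\<in>?N. ?s i l)"
      using l U by (simp add: eq insert_absorb)
  qed
  also have "\<dots> = of_nat (card ?D) * g (P, Q) + (\<Sum>i\<in>?N. \<Sum>l\<in>?D. ?s i l)"
    by (subst sum.swap) (simp add: sum.distrib)
  finally have 2: "lefschetz (lefschetz_adjoint U g) (P, Q) = of_nat (card ?D) * g (P, Q) + (\<Sum>i\<in>?N. \<Sum>l\<in>?D. ?s i l)" .
  have "card ?N + card (P \<union> Q) = card U"
    using x U fin by (metis (no_types, lifting) PowD SigmaE Un_least add.commute card_Diff_subset card_mono finite_UnI le_add_diff_inverse prod.inject)
  moreover have "card P + card Q = card (P \<union> Q) + card ?D" using fin by (rule card_Un_Int)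
  ultimately have "card U + card ?D = card ?N + card P + card Q" by simp
  then have "(of_nat (card U + card ?D) :: complex) = of_nat (card ?N + card P + card Q)" by simp
  then have N: "of_nat (card ?N) = (of_nat (card ?D) + (of_nat (card U) - of_nat (card P) - of_nat (card Q)) :: complex)"
    by (simp add: algebra_simps)
  show ?thesis unfolding 1 2 N by (simp only: distrib_right add_ac)
qed

text \<open>The squared norm of \<open>lefschetz g\<close> is the inner product of \<open>g\<close>
  with its image under the operator followed by its adjoint; the commutator exchanges the two and
  acts on degree \<open>j\<close> as the scalar \<open>card U - j\<close>.\<close>

lemma lefschetz_norm:
  assumes U: "finite U" and g: "\<And>P Q. (P, Q) \<in> set_pairs U \<Longrightarrow> g (P, Q) \<noteq> 0 \<Longrightarrow> int (card P) + int (card Q) = j"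
  shows "(\<Sum>x\<in>set_pairs U. (cmod (lefschetz g x))\<^sup>2) =
    (\<Sum>x\<in>set_pairs U. (cmod (lefschetz_adjoint U g x))\<^sup>2) + of_int (int (card U) - j) * (\<Sum>x\<in>set_pairs U. (cmod (g x))\<^sup>2)"
proof -
  let ?V = "set_pairs U" and ?L = lefschetz and ?A = "lefschetz_adjoint U"
  have cnj_L: "(\<lambda>x. cnj (?L h x)) = ?L (\<lambda>x. cnj (h x))" and cnj_A: "(\<lambda>x. cnj (?A h x)) = ?A (\<lambda>x. cnj (h x))" for h
    by (auto simp: lefschetz_def lefschetz_adjoint_def)
  have norm: "complex_of_real (\<Sum>x\<in>?V. (cmod (h x))\<^sup>2) = (\<Sum>x\<in>?V. h x * cnj (h x))" for h
    by (simp add: complex_norm_square[symmetric])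
  have "complex_of_real (\<Sum>x\<in>?V. (cmod (?L g x))\<^sup>2) = (\<Sum>x\<in>?V. ?L g x * ?L (\<lambda>x. cnj (g x)) x)"
    unfolding norm cnj_L[symmetric] ..
  also have "\<dots> = (\<Sum>x\<in>?V. g x * ?A (?L (\<lambda>x. cnj (g x))) x)"
    by (rule lefschetz_adjointness[OF U])
  also have "\<dots> = (\<Sum>x\<in>?V. g x * ?L (?A (\<lambda>x. cnj (g x))) x + of_int (int (card U) - j) * (g x * cnj (g x)))"
  proof (rule sum.cong[OF refl])
    fix x assume x: "x \<in> ?V"
    obtain P Q where PQ: "x = (P, Q)" by (cases x)
    show "g x * ?A (?L (\<lambda>x. cnj (g x))) x = g x * ?L (?A (\<lambda>x. cnj (g x))) x + of_int (int (card U) - j) * (g x * cnj (g x))"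
    proof (cases "g x = 0")
      case False
      then have "j = int (card P) + int (card Q)" using g x PQ by simp
      moreover have "(P, Q) \<in> ?V" using x PQ by simp
      ultimately show ?thesis
        unfolding PQ by (subst lefschetz_commutator[OF U]) (auto simp: algebra_simps)
    qed simp
  qed
  also have "\<dots> = (\<Sum>x\<in>?V. ?L (?A (\<lambda>x. cnj (g x))) x * g x) + of_int (int (card U) - j) * (\<Sum>x\<in>?V. g x * cnj (g x))"
    by (simp add: sum.distrib sum_distrib_left mult.commute)
  also have "(\<Sum>x\<in>?V. ?L (?A (\<lambda>x. cnj (g x))) x * g x) = (\<Sum>x\<in>?V. ?A (\<lambda>x. cnj (g x)) x * ?A g x)"
    by (rule lefschetz_adjointness[OF U])
  also have "\<dots> = (\<Sum>x\<in>?V. ?A g x * cnj (?A g x))"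
    by (simp add: cnj_A[symmetric] mult.commute)
  finally have "complex_of_real (\<Sum>x\<in>?V. (cmod (?L g x))\<^sup>2) = complex_of_real
      ((\<Sum>x\<in>?V. (cmod (?A g x))\<^sup>2) + of_int (int (card U) - j) * (\<Sum>x\<in>?V. (cmod (g x))\<^sup>2))"
    by (simp only: norm[symmetric] of_real_add of_real_mult of_real_of_int_eq)
  then show ?thesis by (simp only: of_real_eq_iff)
qed

section \<open>The Lefschetz operator in weight zero\<close>

text \<open>The monomials of weight 0 and degree \<open>j\<close>. Integer degrees allow shifts
  below 0, where the set is empty.\<close>

definition level :: "'i set \<Rightarrow> int \<Rightarrow> ('i set \<times> 'i set) set" where
  "level U j = {(P, Q). P \<subseteq> U \<and> Q \<subseteq> U \<and> card P = card Q \<and> int (card P) + int (card Q) = j}"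

lemma finite_level: "finite U \<Longrightarrow> finite (level U j)"
  by (rule finite_subset[of _ "set_pairs U"]) (auto simp: level_def)

lemma card_level:
  assumes "finite U"
  shows "int (card (level U j)) = (if even j then (binom (card U) (j div 2))\<^sup>2 else 0)"
proof (cases "even j \<and> j \<ge> 0")
  case True
  then obtain m where j: "j = 2 * int m" by (metis dvd_def nonneg_int_cases zero_le_mult_iff zero_less_numeral not_less)
  have "level U j = {P. P \<subseteq> U \<and> card P = m} \<times> {Q. Q \<subseteq> U \<and> card Q = m}"
    by (auto simp: level_def j)
  then show ?thesis
    using assms by (simp add: j card_cartesian_product n_subsets binom_def power2_eq_square)
next
  case False
  then have "level U j = {}" by (auto simp: level_def)
  then show ?thesis using False by (auto simp: binom_def)
qed

lemma level_remove:
  assumes "finite U" "P \<subseteq> U" "Q \<subseteq> U" "i \<in> P \<inter> Q"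
  shows "(P - {i}, Q - {i}) \<in> level U j \<longleftrightarrow> (P, Q) \<in> level U (j + 2)"
proof -
  have "finite P" "finite Q" using assms by (auto intro: finite_subset)
  then have "card P = Suc (card (P - {i}))" "card Q = Suc (card (Q - {i}))"
    using assms(4) by (blast intro: card.remove)+
  then show ?thesis using assms by (auto simp: level_def)
qed

lemma level_insert:
  assumes "finite U" "P \<subseteq> U" "Q \<subseteq> U" "i \<in> U - (P \<union> Q)"
  shows "(insert i P, insert i Q) \<in> level U (j + 2) \<longleftrightarrow> (P, Q) \<in> level U j"
  using level_remove[OF assms(1), of "insert i P" "insert i Q" i j] assms by auto

text \<open>In the norm identity the squared norm of \<open>g\<close> has the positive factor
  \<open>card U - j\<close>, so it vanishes together with the left-hand side.\<close>

lemma lefschetz_injective: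
  assumes U: "finite U" and j: "j < int (card U)" and g: "g \<in> supported_on (level U j)"
    and L: "\<And>x. x \<in> level U (j + 2) \<Longrightarrow> lefschetz g x = 0"
  shows "g = (\<lambda>_. 0)"
proof -
  let ?V = "set_pairs U"
  \<comment> \<open>Off degree j + 2 and weight 0 the sum only meets arguments outside the support
    of \<open>g\<close>.\<close>
  have "lefschetz g x = 0" if x: "x \<in> ?V" for x
  proof (cases "x \<in> level U (j + 2)")
    case False
    obtain P Q where PQ: "x = (P, Q)" by (cases x)
    show ?thesis
      using False x g level_remove[OF U, of P Q _ j] by (simp add: lefschetz_def PQ supported_on_def)
  qed (rule L)
  then have "(\<Sum>x\<in>?V. (cmod (lefschetz g x))\<^sup>2) = 0" by simp
  moreover have "int (card P) + int (card Q) = j" if "g (P, Q) \<noteq> 0" for P Q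
  proof -
    have "(P, Q) \<in> level U (j)" using that g unfolding supported_on_def by blast
    then show ?thesis by (simp add: level_def)
  qed
  ultimately have "(\<Sum>x\<in>?V. (cmod (lefschetz_adjoint U g x))\<^sup>2) + of_int (int (card U) - j) * (\<Sum>x\<in>?V. (cmod (g x))\<^sup>2) = 0"
    using lefschetz_norm[OF U, of g j] by simp
  moreover have "0 \<le> (\<Sum>x\<in>?V. (cmod (lefschetz_adjoint U g x))\<^sup>2)" "0 \<le> (\<Sum>x\<in>?V. (cmod (g x))\<^sup>2)"
    by (simp_all add: sum_nonneg)
  moreover have "real_of_int (int (card U) - j) > 0" using j by linarith
  ultimately have "(\<Sum>x\<in>?V. (cmod (g x))\<^sup>2) = 0"
    by (smt (verit) mult_nonneg_nonneg mult_pos_pos)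
  then have "g x = 0" if "x \<in> ?V" for x
    using that U by (subst (asm) sum_nonneg_eq_0_iff) auto
  moreover have "g x = 0" if "x \<notin> ?V" for x
  proof -
    have "x \<notin> level U (j)" using that by (auto simp: level_def)
    then show ?thesis using g unfolding supported_on_def by blast
  qed
  ultimately show ?thesis by blast
qed

text \<open>The operator composed after its adjoint is an endomorphism of the functions on
  \<open>level U (j + 2)\<close>. It is injective there, hence onto, and the adjoint of a preimage
  of \<open>h\<close> is the required \<open>g\<close>.\<close>

lemma lefschetz_surjective:
  assumes U: "finite U" and j: "j \<ge> int (card U)" and h: "h \<in> supported_on (level U (j + 2))"
  shows "\<exists>g\<in>supported_on (level U j). \<forall>x\<in>level U (j + 2). lefschetz g x = h x"
proof -
  let ?V = "set_pairs U" and ?I = "level U (j + 2)"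
  \<comment> \<open>Both maps are cut off by zero, so that \<open>T\<close> maps the functions
    supported on \<open>?I\<close> to themselves.\<close>
  define A where "A = (\<lambda>h x. if x \<in> level U j then lefschetz_adjoint U h x else 0)"
  define T where "T = (\<lambda>h x. if x \<in> ?I then lefschetz (A h) x else 0)"
  have A: "A h \<in> supported_on (level U j)" for h by (simp add: A_def supported_on_def)
  have lin: "linear_map_on (supported_on ?I) T"
  proof -
    have A_lin: "A (\<lambda>x. f x + g x) = (\<lambda>x. A f x + A g x)" "A (\<lambda>x. c * f x) = (\<lambda>x. c * A f x)" for f g c
      by (auto simp: fun_eq_iff A_def lefschetz_adjoint_add lefschetz_adjoint_scale)
    show ?thesis
      unfolding linear_map_on_def T_def A_lin lefschetz_add lefschetz_scale by auto
  qed
  have inj: "h = (\<lambda>_. 0)" if h: "h \<in> supported_on ?I" and T: "T h = (\<lambda>_. 0)" for h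
  proof -
    \<comment> \<open>The conjugate turns the bilinear pairing into the Hermitian inner product;
      pairing \<open>T h\<close> with \<open>h\<close> then gives the squared norm of the adjoint
      image, which must vanish.\<close>
    let ?h = "\<lambda>x. cnj (h x)"
    have adj: "lefschetz_adjoint U h x = A h x" if x: "x \<in> ?V" for x
    proof (cases "x \<in> level U j")
      case False
      obtain P Q where PQ: "x = (P, Q)" by (cases x)
      show ?thesis
        using False x h level_insert[OF U, of P Q _ j]
        by (simp add: lefschetz_adjoint_def PQ supported_on_def A_def)
    qed (simp add: A_def)
    have "0 = (\<Sum>x\<in>?V. lefschetz (A h) x * ?h x)"
    proof (rule sum.neutral[symmetric, rule_format])
      fix x assume "x \<in> ?V"
      show "lefschetz (A h) x * ?h x = 0"
      proof (cases "x \<in> ?I")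
        case False
        then have "h x = 0" using h unfolding supported_on_def by blast
        then show ?thesis by simp
      qed (use fun_cong[OF T, of x] in \<open>simp add: T_def\<close>)
    qed
    also have "\<dots> = (\<Sum>x\<in>?V. A h x * lefschetz_adjoint U ?h x)"
      by (rule lefschetz_adjointness[OF U])
    also have "\<dots> = (\<Sum>x\<in>?V. of_real ((cmod (lefschetz_adjoint U h x))\<^sup>2))"
      by (intro sum.cong refl)
         (simp only: adj[symmetric] complex_norm_square, simp add: lefschetz_adjoint_def case_prod_unfold)
    finally have "(\<Sum>x\<in>?V. (cmod (lefschetz_adjoint U h x))\<^sup>2) = 0"
      by (metis of_real_eq_0_iff of_real_sum)
    moreover have "int (card P) + int (card Q) = j + 2" if "h (P, Q) \<noteq> 0" for P Q
    proof -
      have "(P, Q) \<in> level U (j + 2)" using that h unfolding supported_on_def by blast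
      then show ?thesis by (simp add: level_def)
    qed
    \<comment> \<open>With the adjoint term gone, a non-negative left-hand side faces the factor
      \<open>card U - (j + 2)\<close>, which is at most -2.\<close>
    ultimately have eq: "(\<Sum>x\<in>?V. (cmod (lefschetz h x))\<^sup>2) = of_int (int (card U) - (j + 2)) * (\<Sum>x\<in>?V. (cmod (h x))\<^sup>2)"
      using lefschetz_norm[OF U, of h "j + 2"] by simp
    have "(\<Sum>x\<in>?V. (cmod (h x))\<^sup>2) = 0"
    proof (rule ccontr)
      assume "(\<Sum>x\<in>?V. (cmod (h x))\<^sup>2) \<noteq> 0"
      moreover have "0 \<le> (\<Sum>x\<in>?V. (cmod (h x))\<^sup>2)" by (simp add: sum_nonneg)
      ultimately have "0 < (\<Sum>x\<in>?V. (cmod (h x))\<^sup>2)" by linarith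
      moreover have "real_of_int (int (card U) - (j + 2)) < 0" using j by linarith
      ultimately have "(\<Sum>x\<in>?V. (cmod (lefschetz h x))\<^sup>2) < 0"
        unfolding eq by (rule mult_neg_pos[rotated])
      then show False using sum_nonneg[of ?V "\<lambda>x. (cmod (lefschetz h x))\<^sup>2"] by simp
    qed
    then have "h x = 0" if "x \<in> ?V" for x
      using that U by (subst (asm) sum_nonneg_eq_0_iff) auto
    moreover have "h x = 0" if "x \<notin> ?V" for x
    proof -
    have "x \<notin> level U (j + 2)" using that by (auto simp: level_def)
    then show ?thesis using h unfolding supported_on_def by blast
  qed
    ultimately show ?thesis by blast
  qed
  have "T ` supported_on ?I = supported_on ?I"
    by (rule injective_supported_on_imp_surjective[OF finite_level[OF U] lin _ inj])
       (auto simp: T_def supported_on_def)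
  then obtain h' where "h = T h'" using h by blast
  then show ?thesis using A by (intro bexI[of _ "A h'"]) (simp_all add: T_def)
qed

text \<open>
  \<open>rank_map\<close> replaces the Lefschetz operator on \<open>level U j\<close> by a map with the same kernel that is
  surjective in every degree.
\<close>
definition rank_index :: "'i set \<Rightarrow> int \<Rightarrow> ('i set \<times> 'i set) set" where
  "rank_index U j = level U (if j < int (card U) then j else j + 2)"

definition rank_map :: "'i set \<Rightarrow> int \<Rightarrow> ('i set \<times> 'i set \<Rightarrow> complex) \<Rightarrow> 'i set \<times> 'i set \<Rightarrow> complex" where
  "rank_map U j g = (if j < int (card U) then g else lefschetz g)"

lemma rank_map_surjective:
  assumes U: "finite U"
  obtains g where "g \<in> supported_on (level U j)" "\<And>x. x \<in> rank_index U j \<Longrightarrow> rank_map U j g x = h x"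
proof (cases "j < int (card U)")
  case True
  then show ?thesis
    by (intro that[of "\<lambda>x. if x \<in> level U j then h x else 0"])
       (auto simp: rank_index_def rank_map_def supported_on_def)
next
  case False
  let ?h = "\<lambda>x. if x \<in> level U (j + 2) then h x else 0"
  obtain g where "g \<in> supported_on (level U j)" "\<forall>x\<in>level U (j + 2). lefschetz g x = ?h x"
    using lefschetz_surjective[OF U, of j ?h] False by (auto simp: supported_on_def)
  then show ?thesis using False by (intro that[of g]) (auto simp: rank_index_def rank_map_def)
qed

text \<open>Below degree \<open>card U\<close> the operator is injective, so its vanishing means
  that \<open>g\<close> vanishes on \<open>level U j\<close>. From that degree on the two conditions
  coincide.\<close>

lemma rank_map_kernel:
  assumes U: "finite U"
  shows "(\<forall>x\<in>rank_index U j. rank_map U j g x = 0) \<longleftrightarrow> (\<forall>x\<in>level U (j + 2). lefschetz g x = 0)"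
proof (cases "j < int (card U)")
  case True
  \<comment> \<open>Only the values of \<open>g\<close> on \<open>level U j\<close> enter, so
    \<open>g\<close> may be cut off there to meet the support condition of injectivity.\<close>
  let ?g = "\<lambda>x. if x \<in> level U j then g x else 0"
  have eq: "lefschetz g x = lefschetz ?g x" if "x \<in> level U (j + 2)" for x
  proof -
    obtain P Q where PQ: "x = (P, Q)" by (cases x)
    then have "P \<subseteq> U" "Q \<subseteq> U" using that by (auto simp: level_def)
    then show ?thesis
      using that level_remove[OF U, of P Q _ j] by (simp add: PQ lefschetz_def)
  qed
  have "?g = (\<lambda>_. 0)" if "\<forall>x\<in>level U (j + 2). lefschetz g x = 0"
    by (rule lefschetz_injective[OF U True]) (use that eq in \<open>auto simp: supported_on_def\<close>)
  moreover have "lefschetz g x = 0" if "\<forall>x\<in>level U j. g x = 0" "x \<in> level U (j + 2)" for x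
  proof -
    have "?g = (\<lambda>_. 0)" using that(1) by auto
    then show ?thesis using eq[OF that(2)] by (simp add: lefschetz_def case_prod_unfold)
  qed
  ultimately show ?thesis
    using True by (auto simp: rank_index_def rank_map_def fun_eq_iff split: if_splits)
qed (simp add: rank_index_def rank_map_def)

lemma rank_map_cong:
  assumes U: "finite U" and x: "x \<in> rank_index U j" and eq: "\<And>y. y \<in> level U j \<Longrightarrow> g y = h y"
  shows "rank_map U j g x = rank_map U j h x"
proof (cases "j < int (card U)")
  case False
  obtain P Q where PQ: "x = (P, Q)" by (cases x)
  have "(P, Q) \<in> level U (j + 2)" "P \<subseteq> U" "Q \<subseteq> U"
    using x False PQ by (auto simp: rank_index_def level_def)
  then show ?thesis
    using False level_remove[OF U, of P Q _ j] eq by (simp add: rank_map_def lefschetz_def PQ)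
qed (use x eq in \<open>simp add: rank_map_def rank_index_def\<close>)

lemma finite_rank_index: "finite U \<Longrightarrow> finite (rank_index U j)"
  by (simp add: rank_index_def finite_level)

definition graded_pairs :: "'i set \<Rightarrow> int \<Rightarrow> ('i set \<times> 'i set) set" where
  "graded_pairs U j = {(P, Q). P \<subseteq> U \<and> Q \<subseteq> U \<and> int (card P) + int (card Q) = j}"

text \<open>The monomials of non-zero weight, on which the weight operator is invertible.\<close>

definition off_level :: "'i set \<Rightarrow> int \<Rightarrow> ('i set \<times> 'i set) set" where
  "off_level U j = graded_pairs U j - level U j"

lemma level_subset_graded_pairs: "level U j \<subseteq> graded_pairs U j"
  by (auto simp: level_def graded_pairs_def)

lemma graded_pairs_subset: "graded_pairs U j \<subseteq> set_pairs U"
  by (auto simp: graded_pairs_def)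

lemma finite_graded_pairs: "finite U \<Longrightarrow> finite (graded_pairs U j)"
  by (rule finite_subset[OF graded_pairs_subset]) simp

lemma card_graded_pairs:
  assumes "finite U"
  shows "card (graded_pairs U j) = card (off_level U j) + card (level U j)"
  unfolding off_level_def
  using card_Diff_subset[OF finite_level[OF assms] level_subset_graded_pairs, of j]
    card_mono[OF finite_graded_pairs[OF assms] level_subset_graded_pairs, of j] by simp

lemma graded_pairs_remove:
  assumes "finite U" "P \<subseteq> U" "Q \<subseteq> U" "i \<in> P \<inter> Q"
  shows "(P - {i}, Q - {i}) \<in> graded_pairs U j \<longleftrightarrow> (P, Q) \<in> graded_pairs U (j + 2)"
proof -
  have "finite P" "finite Q" using assms by (auto intro: finite_subset)
  then have "card P = Suc (card (P - {i}))" "card Q = Suc (card (Q - {i}))"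
    using assms(4) by (blast intro: card.remove)+
  then show ?thesis using assms by (auto simp: graded_pairs_def)
qed

lemma level_negative: "j < 0 \<Longrightarrow> level U j = {}"
  by (auto simp: level_def)

lemma off_level_negative: "j < 0 \<Longrightarrow> off_level U j = {}"
  by (auto simp: off_level_def graded_pairs_def)

section \<open>The diamond Lie algebra in coordinates\<close>

context diamond_lie_algebra
begin

text \<open>The index list is an argument so that formulas for the differential can be proved by
  induction on it.\<close>

primrec block :: "nat set \<Rightarrow> nat set \<Rightarrow> nat list \<Rightarrow> 'a list" where
  "block P Q [] = []"
| "block P Q (i # is) = (if i \<in> P then [X i] else []) @ (if i \<in> Q then [Y i] else []) @ block P Q is"

lemma set_block: "set (block P Q is) = X ` (P \<inter> set is) \<union> Y ` (Q \<inter> set is)"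
  by (induction "is") auto

lemma block_cong: "P \<inter> set is = P' \<inter> set is \<Longrightarrow> Q \<inter> set is = Q' \<inter> set is \<Longrightarrow> block P Q is = block P' Q' is"
  by (induction "is") (simp_all, blast+)

lemma X_Y_neq:
  assumes "i \<le> n" "j \<le> n"
  shows "X i \<noteq> Y j"
proof
  assume eq: "X i = Y j"
  have "X i \<in> X ` {0..n}" using assms(1) by (intro imageI) simp
  moreover have "X i \<in> Y ` {0..n}" unfolding eq using assms(2) by (intro imageI) simp
  ultimately show False using disjoint_X_Y by blast
qed

lemma X_eq_iff: "i \<le> n \<Longrightarrow> j \<le> n \<Longrightarrow> X i = X j \<longleftrightarrow> i = j"
  using inj_X by (auto simp: inj_on_def)

lemma Y_eq_iff: "i \<le> n \<Longrightarrow> j \<le> n \<Longrightarrow> Y i = Y j \<longleftrightarrow> i = j"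
  using inj_Y by (auto simp: inj_on_def)

lemma length_block: "distinct is \<Longrightarrow> length (block P Q is) = card (P \<inter> set is) + card (Q \<inter> set is)"
  by (induction "is") auto

lemma distinct_block: "distinct is \<Longrightarrow> set is \<subseteq> {0..n} \<Longrightarrow> distinct (block P Q is)"
  by (induction "is") (auto simp: set_block X_Y_neq X_Y_neq[symmetric] X_eq_iff Y_eq_iff)

lemma bracket_Y_X: "i \<in> {1..n} \<Longrightarrow> j \<in> {1..n} \<Longrightarrow> i \<noteq> j \<Longrightarrow> bracket (Y i) (X j) = 0"
  using bracket_antisym[of "Y i" "X j"] bracket_X_Y_diff[of j i] by simp

text \<open>Distinct indices do not interact, so contracting with X_i or Y_i creates no bracket
  terms with the other indices.\<close>

lemma bracket_X_block:
  assumes "i \<in> {1..n}" "i \<notin> set is" "set is \<subseteq> {1..n}" "y \<in> set (block P Q is)"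
  shows "bracket (X i) y = 0" "bracket (Y i) y = 0"
proof -
  consider l where "y = X l" "l \<in> set is" | l where "y = Y l" "l \<in> set is"
    using assms(4) by (auto simp: set_block)
  then have "bracket (X i) y = 0 \<and> bracket (Y i) y = 0"
  proof cases
    case 1
    then have "l \<in> {1..n}" "l \<noteq> i" using assms by auto
    then show ?thesis using 1 assms(1) bracket_X_X bracket_Y_X by auto
  next
    case 2
    then have "l \<in> {1..n}" "l \<noteq> i" using assms by auto
    then show ?thesis using 2 assms(1) bracket_Y_Y bracket_X_Y_diff by auto
  qed
  then show "bracket (X i) y = 0" "bracket (Y i) y = 0" by auto
qed

lemma bracket_X0_block:
  assumes "set is \<subseteq> {1..n}" "y \<in> set (block P Q is)"
  shows "bracket (X 0) y = 0"
proof -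
  consider l where "y = X l" "l \<in> set is" | l where "y = Y l" "l \<in> set is"
    using assms(2) by (auto simp: set_block)
  then show ?thesis
    using assms(1) bracket_X_X bracket_X0_Y by cases auto
qed

text \<open>Listing \<open>X\<^sub>i\<close> and \<open>Y\<^sub>i\<close> next to each other makes all signs in this formula equal.\<close>
lemma differential_block:
  assumes "f \<in> cochains k" "distinct is" "set is \<subseteq> {1..n}"
  shows "differential f (block P Q is) =
    - (\<Sum>i\<in>P \<inter> Q \<inter> set is. f (X 0 # block (P - {i}) (Q - {i}) is))"
  using assms
proof (induction "is" arbitrary: f k)
  case Nil
  show ?case by (simp add: differential_def)
next
  case (Cons i "is")
  note f = Cons.prems(1)
  have i: "i \<in> {1..n}" "i \<notin> set is" and d: "distinct is" "set is \<subseteq> {1..n}" using Cons.prems by auto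
  let ?b = "block P Q is" and ?I = "P \<inter> Q \<inter> set is"
  let ?b' = "\<lambda>l. block (P - {l}) (Q - {l}) is"
  have ne: "l \<noteq> i" if "l \<in> ?I" for l using that i by auto
  note comm = bracket_X_block[OF i d(2)]
  note swap = cochains_swap[where as = "[]", simplified]
  consider "i \<notin> P" "i \<notin> Q" | "i \<in> P" "i \<notin> Q" | "i \<notin> P" "i \<in> Q" | "i \<in> P" "i \<in> Q" by blast
  then show ?case
  proof cases
    case 1
    have "P \<inter> Q \<inter> set (i # is) = ?I" using 1 by auto
    then show ?thesis using Cons.IH[OF f d] 1 by simp
  next
    case 2
    have I: "P \<inter> Q \<inter> set (i # is) = ?I" using 2 by auto
    have "differential f (block P Q (i # is)) = - differential (\<lambda>ys. f (X i # ys)) ?b"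
      using 2 differential_Cons_commuting[OF f comm(1)] by simp
    also have "\<dots> = (\<Sum>l\<in>?I. f (X i # X 0 # ?b' l))"
      by (simp add: Cons.IH[OF cochains_contract[OF f] d])
    \<comment> \<open>Moving \<open>X 0\<close> to the front past the single entry
      \<open>X i\<close> makes up for the sign of the contraction.\<close>
    also have "\<dots> = (\<Sum>l\<in>?I. - f (X 0 # block (P - {l}) (Q - {l}) (i # is)))"
      using 2 ne swap[OF f, of "X i" "X 0"] by (intro sum.cong refl) auto
    finally show ?thesis by (simp only: I sum_negf)
  next
    case 3
    have I: "P \<inter> Q \<inter> set (i # is) = ?I" using 3 by auto
    have "differential f (block P Q (i # is)) = - differential (\<lambda>ys. f (Y i # ys)) ?b"
      using 3 differential_Cons_commuting[OF f comm(2)] by simp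
    also have "\<dots> = (\<Sum>l\<in>?I. f (Y i # X 0 # ?b' l))"
      by (simp add: Cons.IH[OF cochains_contract[OF f] d])
    also have "\<dots> = (\<Sum>l\<in>?I. - f (X 0 # block (P - {l}) (Q - {l}) (i # is)))"
      using 3 ne swap[OF f, of "Y i" "X 0"] by (intro sum.cong refl) auto
    finally show ?thesis by (simp only: I sum_negf)
  next
    case 4
    have I: "P \<inter> Q \<inter> set (i # is) = insert i ?I" using 4 by auto
    have fX: "(\<lambda>ys. f (X i # ys)) \<in> cochains (k - 1)" by (rule cochains_contract[OF f])
    \<comment> \<open>Among the entries after \<open>X i\<close> only \<open>Y i\<close> has a
      non-zero bracket with it. This bracket is \<open>X 0\<close> and supplies the new summand l =
      i; the others arise after two contractions and two exchanges, so without a change of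
      sign.\<close>
    have "(\<Sum>j<length (Y i # ?b). f ((Y i # ?b)[j := bracket (X i) ((Y i # ?b) ! j)])) =
        f (bracket (X i) (Y i) # ?b) + (\<Sum>j<length ?b. f (Y i # ?b[j := bracket (X i) (?b ! j)]))"
      by (simp add: sum.lessThan_Suc_shift del: sum.lessThan_Suc)
    also have "(\<Sum>j<length ?b. f (Y i # ?b[j := bracket (X i) (?b ! j)])) = 0"
    proof (rule sum.neutral, rule ballI)
      fix j assume "j \<in> {..<length ?b}"
      then show "f (Y i # ?b[j := bracket (X i) (?b ! j)]) = 0"
        using cochains_update(1)[OF f, of "Suc j" "Y i # ?b"] comm(1)[OF nth_mem[of j ?b]] by simp
    qed
    finally have "differential f (block P Q (i # is)) =
        - f (X 0 # ?b) - differential (\<lambda>ys. f (X i # ys)) (Y i # ?b)"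
      using 4 bracket_X_Y_same[OF i(1)] by (simp add: differential_Cons[OF f])
    also have "differential (\<lambda>ys. f (X i # ys)) (Y i # ?b) =
        - differential (\<lambda>ys. f (X i # Y i # ys)) ?b"
      by (rule differential_Cons_commuting[OF fX comm(2)])
    also have "\<dots> = (\<Sum>l\<in>?I. f (X i # Y i # X 0 # ?b' l))"
      by (simp add: Cons.IH[OF cochains_contract[OF fX] d])
    also have "\<dots> = (\<Sum>l\<in>?I. f (X 0 # block (P - {l}) (Q - {l}) (i # is)))"
    proof (intro sum.cong refl)
      fix l assume "l \<in> ?I"
      then show "f (X i # Y i # X 0 # ?b' l) = f (X 0 # block (P - {l}) (Q - {l}) (i # is))"
        using 4 ne[of l] swap[OF f, of "X i" "X 0" "Y i # ?b' l"]
          cochains_swap[OF f, of "[X i]" "Y i" "X 0" "?b' l"] by simp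
    qed
    also have "X 0 # ?b = X 0 # block (P - {i}) (Q - {i}) (i # is)"
      using i(2) by (simp, intro block_cong) auto
    finally show ?thesis unfolding I using i(2) by simp
  qed
qed

lemma weight_block:
  assumes f: "f \<in> cochains k" and "distinct is" "set is \<subseteq> {1..n}"
  shows "(\<Sum>j<length (block P Q is). f ((block P Q is)[j := bracket (Y 0) (block P Q is ! j)])) =
    (of_nat (card (P \<inter> set is)) - of_nat (card (Q \<inter> set is))) * f (block P Q is)"
proof -
  let ?b = "block P Q is"
  \<comment> \<open>The eigenvalue of the bracket with \<open>Y 0\<close> on an entry of the
    block.\<close>
  define \<epsilon> :: "'a \<Rightarrow> complex" where "\<epsilon> y = (if y \<in> X ` {1..n} then 1 else - 1)" for y
  have "f (?b[j := bracket (Y 0) (?b ! j)]) = \<epsilon> (?b ! j) * f ?b" if j: "j < length ?b" for j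
  proof -
    consider l where "?b ! j = X l" "l \<in> {1..n}" | l where "?b ! j = Y l" "l \<in> {1..n}"
      using nth_mem[OF j] assms(3) by (auto simp: set_block)
    then show ?thesis
    proof cases
      case 1
      then have "bracket (Y 0) (?b ! j) = ?b ! j" using bracket_Y0_X by simp
      moreover have "\<epsilon> (?b ! j) = 1" using 1 by (simp add: \<epsilon>_def)
      ultimately show ?thesis by simp
    next
      case 2
      then have "bracket (Y 0) (?b ! j) = - (?b ! j)" using bracket_Y0_Y by simp
      moreover have "?b ! j \<notin> X ` {1..n}" using 2 X_Y_neq by fastforce
      ultimately show ?thesis by (simp add: \<epsilon>_def cochains_update(2)[OF f j])
    qed
  qed
  then have "(\<Sum>j<length ?b. f (?b[j := bracket (Y 0) (?b ! j)])) = (\<Sum>j<length ?b. \<epsilon> (?b ! j)) * f ?b"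
    by (simp add: sum_distrib_right)
  also have "(\<Sum>j<length ?b. \<epsilon> (?b ! j)) = sum_list (map \<epsilon> ?b)"
    by (simp add: sum_list_sum_nth atLeast0LessThan)
  also have "\<dots> = of_nat (card (P \<inter> set is)) - of_nat (card (Q \<inter> set is))"
    using assms(2,3)
  proof (induction "is")
    case (Cons i "is")
    then have "i \<le> n" "i \<in> {1..n}" by auto
    then have "Y i \<notin> X ` {1..n}" "X i \<in> X ` {1..n}" using X_Y_neq by fastforce+
    then show ?case using Cons by (auto simp: \<epsilon>_def)
  qed simp
  finally show ?thesis .
qed

section \<open>The differential on words of basis vectors\<close>

text \<open>The flags record whether \<open>X 0\<close> and \<open>Y 0\<close> occur. With flags FF,
  TF, FT, TT the values of a cochain on words are its components a, b, c, e.\<close>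

definition word :: "bool \<Rightarrow> bool \<Rightarrow> nat set \<times> nat set \<Rightarrow> 'a list" where
  "word p q x = (if p then [X 0] else []) @ (if q then [Y 0] else []) @ block (fst x) (snd x) [1..<Suc n]"

abbreviation pairs :: "(nat set \<times> nat set) set" where
  "pairs \<equiv> set_pairs {1..n}"

definition weight :: "nat set \<times> nat set \<Rightarrow> complex" where
  "weight x = of_nat (card (fst x)) - of_nat (card (snd x))"

lemma upt_1: "set [1..<Suc n] = {1..n}" by auto

lemma pairs_Int: "x \<in> pairs \<Longrightarrow> fst x \<inter> set [1..<Suc n] = fst x \<and> snd x \<inter> set [1..<Suc n] = snd x"
  unfolding upt_1 by auto

lemma length_word:
  assumes "x \<in> pairs"
  shows "length (word p q x) = of_bool p + of_bool q + card (fst x) + card (snd x)"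
  using pairs_Int[OF assms] length_block[of "[1..<Suc n]" "fst x" "snd x"]
  by (simp add: word_def del: upt_Suc)

text \<open>\<open>X 0\<close> is central and every bracket of X_i with Y_i produces another
  \<open>X 0\<close>, so on words that already contain it these terms vanish by alternation.
  Brackets with \<open>Y 0\<close> contribute the weight.\<close>

lemma differential_word:
  assumes f: "f \<in> cochains k" and x: "x \<in> pairs"
  shows "differential f (word False False x) = - lefschetz (\<lambda>x. f (word True False x)) x"
    and "differential f (word False True x) =
      - (weight x * f (word False False x) + lefschetz (\<lambda>x. f (word True True x)) x)"
    and "differential f (word True False x) = 0"
    and "differential f (word True True x) = weight x * f (word True False x)"
proof -
  obtain P Q where PQ: "x = (P, Q)" by (cases x)
  let ?is = "[1..<Suc n]"
  let ?b = "block P Q ?is"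
  have sub: "set ?is \<subseteq> {1..n}" and dist: "distinct ?is" by auto
  have Int: "P \<inter> set ?is = P" "Q \<inter> set ?is = Q" "P \<inter> Q \<inter> set ?is = P \<inter> Q"
    using pairs_Int[OF x] PQ by auto
  note block = differential_block[OF _ dist sub, of _ _ P Q, unfolded Int]
  note weight = weight_block[OF _ dist sub, of _ _ P Q, unfolded Int]
  have comm: "bracket (X 0) y = 0" if "y \<in> set ?b" for y
    by (rule bracket_X0_block[OF sub that])
  note swap = cochains_swap[where as = "[]", simplified]
  note adj = cochains_adjacent[where as = "[]", simplified]
  have lef: "lefschetz g x = (\<Sum>i\<in>P \<inter> Q. g (P - {i}, Q - {i}))" for g
    by (simp add: lefschetz_def PQ)
  have wt: "weight x = of_nat (card P) - of_nat (card Q)" by (simp add: weight_def PQ)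
  have fX: "(\<lambda>ys. f (X 0 # ys)) \<in> cochains (k - 1)" and fY: "(\<lambda>ys. f (Y 0 # ys)) \<in> cochains (k - 1)"
    by (rule cochains_contract[OF f])+
  have fXY: "(\<lambda>ys. f (X 0 # Y 0 # ys)) \<in> cochains (k - 1 - 1)"
    by (rule cochains_contract[OF fX])
  have w [simp]: "word False False y = block (fst y) (snd y) ?is" "word True False y = X 0 # block (fst y) (snd y) ?is"
    "word False True y = Y 0 # block (fst y) (snd y) ?is" "word True True y = X 0 # Y 0 # block (fst y) (snd y) ?is" for y
    by (simp_all add: word_def)
  have [simp]: "fst x = P" "snd x = Q" by (simp_all add: PQ)
  show "differential f (word False False x) = - lefschetz (\<lambda>x. f (word True False x)) x"
    by (simp add: block[OF f] lef del: upt_Suc One_nat_def)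
  show "differential f (word True False x) = 0"
    using differential_Cons_commuting[OF f comm] block[OF fX] adj[OF f] by (simp del: upt_Suc One_nat_def)
  have "differential f (Y 0 # ?b) = - (weight x * f ?b) - differential (\<lambda>ys. f (Y 0 # ys)) ?b"
    unfolding differential_Cons[OF f] weight[OF f] wt ..
  also have "differential (\<lambda>ys. f (Y 0 # ys)) ?b = - (\<Sum>i\<in>P \<inter> Q. f (Y 0 # X 0 # block (P - {i}) (Q - {i}) ?is))"
    by (rule block[OF fY])
  also have "\<dots> = lefschetz (\<lambda>x. f (word True True x)) x"
    by (simp add: lef swap[OF f, of "Y 0" "X 0"] sum_negf del: upt_Suc One_nat_def)
  finally show "differential f (word False True x) =
      - (weight x * f (word False False x) + lefschetz (\<lambda>x. f (word True True x)) x)"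
    by (simp del: upt_Suc One_nat_def)
  have "bracket (X 0) y = 0" if "y \<in> set (Y 0 # ?b)" for y
    using that comm[of y] bracket_X0_Y[of 0] by auto
  then have "differential f (X 0 # Y 0 # ?b) = - differential (\<lambda>ys. f (X 0 # ys)) (Y 0 # ?b)"
    by (rule differential_Cons_commuting[OF f])
  also have "\<dots> = weight x * f (X 0 # ?b) + differential (\<lambda>ys. f (X 0 # Y 0 # ys)) ?b"
    unfolding differential_Cons[OF fX] weight[OF fX] wt by (simp del: upt_Suc One_nat_def)
  also have "differential (\<lambda>ys. f (X 0 # Y 0 # ys)) ?b =
      - (\<Sum>i\<in>P \<inter> Q. f (X 0 # Y 0 # X 0 # block (P - {i}) (Q - {i}) ?is))"
    by (rule block[OF fXY])
  also have "\<dots> = 0"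
    using cochains_swap[OF f, of "[X 0]" "Y 0" "X 0"] adj[OF f, of "X 0"] by (simp del: upt_Suc One_nat_def)
  finally show "differential f (word True True x) = weight x * f (word True False x)"
    by (simp del: upt_Suc One_nat_def)
qed

abbreviation XY_basis :: "'a set" where
  "XY_basis \<equiv> X ` {0..n} \<union> Y ` {0..n}"

lemma mem_X_Y:
  assumes "i \<le> n" "P \<subseteq> {0..n}" "Q \<subseteq> {0..n}"
  shows "X i \<in> X ` P \<union> Y ` Q \<longleftrightarrow> i \<in> P" "Y i \<in> X ` P \<union> Y ` Q \<longleftrightarrow> i \<in> Q"
proof -
  have "X i \<notin> Y ` Q" "Y i \<notin> X ` P"
    using X_Y_neq assms by (metis atLeastAtMost_iff imageE subsetD)+
  then show "X i \<in> X ` P \<union> Y ` Q \<longleftrightarrow> i \<in> P" "Y i \<in> X ` P \<union> Y ` Q \<longleftrightarrow> i \<in> Q"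
    using inj_on_image_mem_iff[OF inj_X _ assms(2), of i] inj_on_image_mem_iff[OF inj_Y _ assms(3), of i] assms(1)
    by auto
qed

lemma set_word:
  assumes "x \<in> pairs"
  shows "set (word p q x) = X ` ({i. i = 0 \<and> p} \<union> fst x) \<union> Y ` ({i. i = 0 \<and> q} \<union> snd x)"
  using pairs_Int[OF assms] by (auto simp: word_def set_block simp del: upt_Suc)

lemma mem_set_word:
  assumes x: "x \<in> pairs" and "i \<le> n"
  shows "X i \<in> set (word p q x) \<longleftrightarrow> (if i = 0 then p else i \<in> fst x)"
    "Y i \<in> set (word p q x) \<longleftrightarrow> (if i = 0 then q else i \<in> snd x)"
proof -
  have "{i. i = 0 \<and> p} \<union> fst x \<subseteq> {0..n}" "{i. i = 0 \<and> q} \<union> snd x \<subseteq> {0..n}" "0 \<notin> fst x" "0 \<notin> snd x"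
    using x by auto
  then show "X i \<in> set (word p q x) \<longleftrightarrow> (if i = 0 then p else i \<in> fst x)"
    "Y i \<in> set (word p q x) \<longleftrightarrow> (if i = 0 then q else i \<in> snd x)"
    using mem_X_Y[OF assms(2)] unfolding set_word[OF x] by simp_all
qed

lemma word_basis:
  assumes x: "x \<in> pairs"
  shows "set (word p q x) \<subseteq> XY_basis" "distinct (word p q x)"
proof -
  show "set (word p q x) \<subseteq> XY_basis" using x unfolding set_word[OF x] by auto
  have eq: "block (fst x) (snd x) [1..<Suc n] = word False False x" by (simp add: word_def)
  have "distinct (word False False x)"
    unfolding eq[symmetric] by (rule distinct_block) auto
  moreover have "X 0 \<notin> set (word False False x)" "Y 0 \<notin> set (word False False x)"
    by (simp_all add: mem_set_word[OF x])
  ultimately show "distinct (word p q x)"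
    using X_Y_neq[of 0 0] unfolding word_def[of p q] eq by simp
qed

lemma word_exhaust:
  assumes "S \<subseteq> XY_basis"
  shows "\<exists>p q. \<exists>x\<in>pairs. set (word p q x) = S"
proof -
  let ?x = "({i \<in> {1..n}. X i \<in> S}, {i \<in> {1..n}. Y i \<in> S})"
  have x: "?x \<in> pairs" by auto
  have "set (word (X 0 \<in> S) (Y 0 \<in> S) ?x) = S"
  proof (intro equalityI subsetI)
    fix y assume "y \<in> S"
    then obtain i where i: "i \<le> n" "y = X i \<or> y = Y i" using assms by auto
    then show "y \<in> set (word (X 0 \<in> S) (Y 0 \<in> S) ?x)"
      using \<open>y \<in> S\<close> unfolding set_word[OF x] by (cases "i = 0") auto
  next
    fix y assume "y \<in> set (word (X 0 \<in> S) (Y 0 \<in> S) ?x)"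
    then show "y \<in> S" unfolding set_word[OF x] by auto
  qed
  then show ?thesis using x by blast
qed

lemma cochain_eq_0I:
  assumes f: "f \<in> cochains k" and "\<And>p q x. x \<in> pairs \<Longrightarrow> f (word p q x) = 0"
  shows "f = (\<lambda>_. 0)"
proof (rule cochain_eq_0_on_spanning_set[OF f span_X_Y])
  fix xs :: "'a list" assume xs: "set xs \<subseteq> XY_basis" "distinct xs" "length xs = k"
  then obtain p q x where x: "x \<in> pairs" "set (word p q x) = set xs" using word_exhaust by metis
  then have "mset (word p q x) = mset xs"
    using word_basis(2) xs(2) by (simp add: set_eq_iff_mset_eq_distinct)
  then show "f xs = 0" using cochains_permute[OF f] assms(2)[OF x(1)] by blast
qed

text \<open>These are the equations for the components b, a and e; the component c is
  unconstrained.\<close>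

lemma cocycle_iff:
  assumes f: "f \<in> cochains k"
  shows "differential f = (\<lambda>_. 0) \<longleftrightarrow> (\<forall>x\<in>pairs.
    lefschetz (\<lambda>x. f (word True False x)) x = 0 \<and>
    weight x * f (word False False x) + lefschetz (\<lambda>x. f (word True True x)) x = 0 \<and>
    weight x * f (word True False x) = 0)" (is "_ \<longleftrightarrow> ?R")
proof
  assume d: "differential f = (\<lambda>_. 0)"
  show ?R
  proof
    fix x assume x: "x \<in> pairs"
    show "lefschetz (\<lambda>x. f (word True False x)) x = 0 \<and>
      weight x * f (word False False x) + lefschetz (\<lambda>x. f (word True True x)) x = 0 \<and>
      weight x * f (word True False x) = 0"
      using differential_word[OF f x, unfolded d] by (simp only: neg_equal_0_iff_equal simp_thms eq_commute[of 0])
  qed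
next
  assume R: ?R
  show "differential f = (\<lambda>_. 0)"
  proof (rule cochain_eq_0I[OF differential_cochains[OF f]])
    fix p q x assume x: "x \<in> pairs"
    show "differential f (word p q x) = 0"
      using bspec[OF R x] differential_word[OF f x] by (cases p; cases q) (simp_all only: neg_equal_0_iff_equal)
  qed
qed

lemma weight_remove:
  assumes "(P, Q) \<in> pairs" "i \<in> P \<inter> Q"
  shows "weight (P - {i}, Q - {i}) = weight (P, Q)"
proof -
  have "finite P" "finite Q" using assms(1) by (auto intro: finite_subset)
  then have "card P = Suc (card (P - {i}))" "card Q = Suc (card (Q - {i}))"
    using assms(2) by (blast intro: card.remove)+
  then show ?thesis by (simp add: weight_def del: card_Diff_insert)
qed

text \<open>The components of \<open>differential f\<close> satisfy the cocycle equations, because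
  the Lefschetz operator preserves the weight.\<close>

lemma differential_differential:
  assumes f: "f \<in> cochains k"
  shows "differential (differential f) = (\<lambda>_. 0)"
  unfolding cocycle_iff[OF differential_cochains[OF f]]
proof (intro ballI conjI)
  fix x assume x: "x \<in> pairs"
  obtain P Q where PQ: "x = (P, Q)" by (cases x)
  have rem: "(P - {i}, Q - {i}) \<in> pairs" for i using x PQ by auto
  show "lefschetz (\<lambda>x. differential f (word True False x)) x = 0"
    using differential_word(3)[OF f rem] by (simp add: lefschetz_def PQ)
  show "weight x * differential f (word True False x) = 0"
    using differential_word(3)[OF f x] by simp
  have "lefschetz (\<lambda>x. differential f (word True True x)) x = weight x * lefschetz (\<lambda>x. f (word True False x)) x"
    using differential_word(4)[OF f rem] weight_remove[of P Q] x
    by (simp add: lefschetz_def PQ sum_distrib_left)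
  then show "weight x * differential f (word False False x) + lefschetz (\<lambda>x. differential f (word True True x)) x = 0"
    using differential_word(1)[OF f x] by simp
qed

end

section \<open>Dimensions of cocycles and cohomology\<close>

text \<open>
  \<open>cocycle_index\<close> enumerates as many linear conditions as are needed to cut the cocycles out of the
  \<open>k\<close>-cochains; \<open>k\<close> is an integer so that the coboundaries in degree \<open>0\<close> need no special treatment.
\<close>
definition cochain_index :: "nat \<Rightarrow> nat \<Rightarrow> ((bool \<times> bool) \<times> nat set \<times> nat set) set" where
  "cochain_index n k = Sigma UNIV (\<lambda>(p, q). graded_pairs {1..n} (int k - of_bool p - of_bool q))"

definition cocycle_index :: "nat \<Rightarrow> int \<Rightarrow> (nat \<times> nat set \<times> nat set) set" where
  "cocycle_index n k = Sigma {0, 1, 2, 3} (\<lambda>t.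
     if t = 0 then off_level {1..n} (k - 1) else if t = 1 then off_level {1..n} k
     else if t = 2 then rank_index {1..n} (k - 1) else rank_index {1..n} (k - 2))"

lemma Ball_cocycle_index:
  "(\<forall>s\<in>cocycle_index n k. A s) \<longleftrightarrow>
     (\<forall>x\<in>off_level {1..n} (k - 1). A (0, x)) \<and> (\<forall>x\<in>off_level {1..n} k. A (1, x)) \<and>
     (\<forall>x\<in>rank_index {1..n} (k - 1). A (2, x)) \<and> (\<forall>x\<in>rank_index {1..n} (k - 2). A (3, x))"
  by (auto simp: cocycle_index_def)

lemma finite_cochain_index: "finite (cochain_index n k)"
  unfolding cochain_index_def by (intro finite_SigmaI) (auto simp: finite_graded_pairs)

lemma finite_cocycle_index: "finite (cocycle_index n k)"
  unfolding cocycle_index_def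
  by (intro finite_SigmaI) (auto simp: off_level_def finite_graded_pairs finite_rank_index)

lemma card_cochain_index:
  "card (cochain_index n k) = card (graded_pairs {1..n} (int k)) + 2 * card (graded_pairs {1..n} (int k - 1)) +
     card (graded_pairs {1..n} (int k - 2))"
proof -
  have "card (cochain_index n k) =
      (\<Sum>pq\<in>UNIV. card (case pq of (p, q) \<Rightarrow> graded_pairs {1..n} (int k - of_bool p - of_bool q)))"
    unfolding cochain_index_def by (intro card_SigmaI) (auto simp: finite_graded_pairs)
  also have "\<dots> = (\<Sum>p\<in>UNIV. \<Sum>q\<in>UNIV. card (graded_pairs {1..n} (int k - of_bool p - of_bool q)))"
    unfolding UNIV_Times_UNIV[symmetric] sum.cartesian_product by (intro sum.cong) auto
  finally show ?thesis by (simp add: UNIV_bool)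
qed

lemma card_cocycle_index:
  "card (cocycle_index n k) = card (off_level {1..n} (k - 1)) + card (off_level {1..n} k) +
     card (rank_index {1..n} (k - 1)) + card (rank_index {1..n} (k - 2))"
  unfolding cocycle_index_def
  by (subst card_SigmaI) (auto simp: off_level_def finite_graded_pairs finite_rank_index)

context diamond_lie_algebra
begin

text \<open>The hypotheses of \<open>cochain_basis\<close> for the family of words of length
  \<open>k\<close>.\<close>

lemma word_cochain_basis:
  "s \<in> cochain_index n k \<Longrightarrow> snd s \<in> pairs"
  "s \<in> cochain_index n k \<Longrightarrow> length (word (fst (fst s)) (snd (fst s)) (snd s)) = k"
  "s \<in> cochain_index n k \<Longrightarrow> set (word (fst (fst s)) (snd (fst s)) (snd s)) \<subseteq> XY_basis"
  "s \<in> cochain_index n k \<Longrightarrow> distinct (word (fst (fst s)) (snd (fst s)) (snd s))"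
  "inj_on (\<lambda>s. set (word (fst (fst s)) (snd (fst s)) (snd s))) (cochain_index n k)"
proof -
  show pairs: "s \<in> cochain_index n k \<Longrightarrow> snd s \<in> pairs" for s
    by (auto simp: cochain_index_def graded_pairs_def)
  show "s \<in> cochain_index n k \<Longrightarrow> set (word (fst (fst s)) (snd (fst s)) (snd s)) \<subseteq> XY_basis"
    "s \<in> cochain_index n k \<Longrightarrow> distinct (word (fst (fst s)) (snd (fst s)) (snd s))" for s
    using word_basis[OF pairs] by blast+
  show "s \<in> cochain_index n k \<Longrightarrow> length (word (fst (fst s)) (snd (fst s)) (snd s)) = k" for s
    using length_word[OF pairs, of s] by (auto simp: cochain_index_def graded_pairs_def)
  show "inj_on (\<lambda>s. set (word (fst (fst s)) (snd (fst s)) (snd s))) (cochain_index n k)"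
  proof (rule inj_onI)
    fix s t assume s: "s \<in> cochain_index n k" and t: "t \<in> cochain_index n k"
      and eq: "set (word (fst (fst s)) (snd (fst s)) (snd s)) = set (word (fst (fst t)) (snd (fst t)) (snd t))"
    note s' = pairs[OF s] and t' = pairs[OF t]
    have "X 0 \<in> set (word p q (snd s)) \<longleftrightarrow> p" "Y 0 \<in> set (word p q (snd s)) \<longleftrightarrow> q"
      "X 0 \<in> set (word p q (snd t)) \<longleftrightarrow> p" "Y 0 \<in> set (word p q (snd t)) \<longleftrightarrow> q" for p q
      using mem_set_word[OF s', of 0] mem_set_word[OF t', of 0] by simp_all
    then have "fst (fst s) = fst (fst t)" "snd (fst s) = snd (fst t)"
      using eq by metis+
    moreover have "fst (snd s) = fst (snd t)" "snd (snd s) = snd (snd t)"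
    proof -
      have "X i \<in> set (word p q (snd s)) \<longleftrightarrow> i \<in> fst (snd s)" "Y i \<in> set (word p q (snd s)) \<longleftrightarrow> i \<in> snd (snd s)"
        "X i \<in> set (word p q (snd t)) \<longleftrightarrow> i \<in> fst (snd t)" "Y i \<in> set (word p q (snd t)) \<longleftrightarrow> i \<in> snd (snd t)"
        if "i \<in> {1..n}" for i p q
        using mem_set_word[OF s', of i] mem_set_word[OF t', of i] that by simp_all
      then have "\<forall>i\<in>{1..n}. i \<in> fst (snd s) \<longleftrightarrow> i \<in> fst (snd t)" "\<forall>i\<in>{1..n}. i \<in> snd (snd s) \<longleftrightarrow> i \<in> snd (snd t)"
        using eq by metis+
      then show "fst (snd s) = fst (snd t)" "snd (snd s) = snd (snd t)"
        using s' t' unfolding mem_Times_iff Pow_iff by blast+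
    qed
    ultimately show "s = t" by (simp add: prod_eq_iff)
  qed
qed

lemma cochain_with_values:
  "\<exists>f\<in>cochains k. \<forall>p q x. ((p, q), x) \<in> cochain_index n k \<longrightarrow> f (word p q x) = g ((p, q), x)"
proof -
  have "\<exists>f\<in>cochains k. \<forall>s\<in>cochain_index n k. f (word (fst (fst s)) (snd (fst s)) (snd s)) = g s"
    by (rule cochain_extension[OF independent_X_Y span_X_Y finite_cochain_index])
       (simp_all only: word_cochain_basis simp_thms)
  then show ?thesis by fastforce
qed

lemma fdim_cochains: "fdim (cochains k) = card (cochain_index n k)" "finite_dim (cochains k)"
proof -
  have "fdim (cochains k) = card (cochain_index n k) \<and> finite_dim (cochains k)"
  proof (rule cochain_basis(2)[OF independent_X_Y span_X_Y finite_cochain_index, where l = "\<lambda>s. word (fst (fst s)) (snd (fst s)) (snd s)"])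
    fix xs :: "'a list" assume xs: "set xs \<subseteq> XY_basis" "distinct xs" "length xs = k"
    then obtain p q x where x: "x \<in> pairs" "set (word p q x) = set xs" using word_exhaust by metis
    then have "length (word p q x) = k"
      using word_basis(2)[OF x(1), of p q] xs by (metis distinct_card)
    then have "((p, q), x) \<in> cochain_index n k"
      using length_word[OF x(1), of p q] x(1) by (auto simp: cochain_index_def graded_pairs_def)
    then show "\<exists>s\<in>cochain_index n k. set (word (fst (fst s)) (snd (fst s)) (snd s)) = set xs"
      using x(2) by force
  qed (simp_all only: word_cochain_basis simp_thms)
  then show "fdim (cochains k) = card (cochain_index n k)" "finite_dim (cochains k)" by auto
qed

section \<open>Independent linear conditions for cocycles\<close>

text \<open>In the order of \<open>t\<close>: b vanishes in non-zero weight;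
  \<open>w a + L e\<close> vanishes in non-zero weight; \<open>L b\<close> vanishes in weight 0;
  \<open>L e\<close> vanishes in weight 0. The last two use \<open>rank_map\<close>, which makes the
  conditions independent.\<close>

definition cocycle_conditions :: "nat \<Rightarrow> ('a list \<Rightarrow> complex) \<Rightarrow> nat \<times> nat set \<times> nat set \<Rightarrow> complex" where
  "cocycle_conditions k f = (\<lambda>(t, x). if (t, x) \<in> cocycle_index n k then
     if t = 0 then f (word True False x)
     else if t = 1 then weight x * f (word False False x) + lefschetz (\<lambda>x. f (word True True x)) x
     else if t = 2 then rank_map {1..n} (int k - 1) (\<lambda>x. f (word True False x)) x
     else rank_map {1..n} (int k - 2) (\<lambda>x. f (word True True x)) x
   else 0)"

lemma linear_map_on_cocycle_conditions: "linear_map_on C (cocycle_conditions k)"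
  unfolding linear_map_on_def cocycle_conditions_def
  by (auto simp: fun_eq_iff rank_map_def lefschetz_add lefschetz_scale algebra_simps)

lemma weight_eq_0_iff: "x \<in> graded_pairs {1..n} j \<Longrightarrow> weight x = 0 \<longleftrightarrow> x \<in> level {1..n} j"
  by (auto simp: weight_def level_def graded_pairs_def)

lemma word_outside:
  assumes "f \<in> cochains k" "x \<in> pairs" "x \<notin> graded_pairs {1..n} (int k - of_bool p - of_bool q)"
  shows "f (word p q x) = 0"
  using assms(2,3) length_word[OF assms(2), of p q]
  by (intro cochains_length[OF assms(1)]) (auto simp: graded_pairs_def)

text \<open>A cochain vanishes on words of the wrong length, so the cocycle equations have content
  in one degree each. There they split according to whether the weight is zero.\<close>

lemma cocycle_conditions_kernel:
  assumes f: "f \<in> cochains k"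
  shows "cocycle_conditions k f = (\<lambda>_. 0) \<longleftrightarrow> differential f = (\<lambda>_. 0)"
proof -
  let ?U = "{1..n}"
  let ?b = "\<lambda>x. f (word True False x)" and ?e = "\<lambda>x. f (word True True x)" and ?a = "\<lambda>x. f (word False False x)"
  have "cocycle_conditions k f = (\<lambda>_. 0) \<longleftrightarrow> (\<forall>s\<in>cocycle_index n k. cocycle_conditions k f s = 0)"
  proof -
    have "cocycle_conditions k f s = 0" if "s \<notin> cocycle_index n k" for s
      using that by (simp add: cocycle_conditions_def case_prod_unfold)
    then show ?thesis unfolding fun_eq_iff by blast
  qed
  also have "\<dots> \<longleftrightarrow> (\<forall>x\<in>off_level ?U (int k - 1). ?b x = 0) \<and>
      (\<forall>x\<in>off_level ?U k. weight x * ?a x + lefschetz ?e x = 0) \<and>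
      (\<forall>x\<in>rank_index ?U (int k - 1). rank_map ?U (int k - 1) ?b x = 0) \<and>
      (\<forall>x\<in>rank_index ?U (int k - 2). rank_map ?U (int k - 2) ?e x = 0)"
  proof -
    have "cocycle_conditions k f (0, x) = ?b x" if "x \<in> off_level ?U (int k - 1)" for x
      using that by (simp add: cocycle_conditions_def cocycle_index_def)
    moreover have "cocycle_conditions k f (1, x) = weight x * ?a x + lefschetz ?e x" if "x \<in> off_level ?U k" for x
      using that by (simp add: cocycle_conditions_def cocycle_index_def)
    moreover have "cocycle_conditions k f (2, x) = rank_map ?U (int k - 1) ?b x" if "x \<in> rank_index ?U (int k - 1)" for x
      using that by (simp add: cocycle_conditions_def cocycle_index_def)
    moreover have "cocycle_conditions k f (3, x) = rank_map ?U (int k - 2) ?e x" if "x \<in> rank_index ?U (int k - 2)" for x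
      using that by (simp add: cocycle_conditions_def cocycle_index_def)
    ultimately show ?thesis by (simp only: Ball_cocycle_index cong: ball_cong)
  qed
  also have "\<dots> \<longleftrightarrow> (\<forall>x\<in>off_level ?U (int k - 1). ?b x = 0) \<and>
      (\<forall>x\<in>off_level ?U k. weight x * ?a x + lefschetz ?e x = 0) \<and>
      (\<forall>x\<in>level ?U (int k + 1). lefschetz ?b x = 0) \<and> (\<forall>x\<in>level ?U k. lefschetz ?e x = 0)"
    (is "_ \<longleftrightarrow> ?R")
    using rank_map_kernel[of ?U "int k - 1" ?b] rank_map_kernel[of ?U "int k - 2" ?e] by (simp add: add.commute)
  also have "?R \<longleftrightarrow> (\<forall>x\<in>pairs. lefschetz ?b x = 0 \<and> weight x * ?a x + lefschetz ?e x = 0 \<and> weight x * ?b x = 0)"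
  proof
    assume R: ?R
    show "\<forall>x\<in>pairs. lefschetz ?b x = 0 \<and> weight x * ?a x + lefschetz ?e x = 0 \<and> weight x * ?b x = 0"
    proof
      fix x assume x: "x \<in> pairs"
      obtain P Q where PQ: "x = (P, Q)" by (cases x)
      have rem: "(P - {i}, Q - {i}) \<in> pairs" for i using x PQ by auto
      have b: "?b y = 0" if "y \<in> pairs" "y \<notin> level ?U (int k - 1)" for y
        using R word_outside[OF f that(1), of True False] that(2) by (auto simp: off_level_def)
      have lb: "lefschetz ?b x = 0"
      proof (cases "x \<in> level ?U (int k + 1)")
        case False
        then have "(P - {i}, Q - {i}) \<notin> level ?U (int k - 1)" if "i \<in> P \<inter> Q" for i
          using level_remove[of ?U P Q i "int k - 1"] that x PQ by (simp add: add.commute)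
        then show ?thesis using b rem by (simp add: lefschetz_def PQ)
      qed (use R in blast)
      have le: "weight x * ?a x + lefschetz ?e x = 0"
      proof (cases "x \<in> graded_pairs ?U k")
        case True
        then show ?thesis
          using R weight_eq_0_iff[OF True] by (cases "x \<in> level ?U k") (auto simp: off_level_def)
      next
        case False
        \<comment> \<open>Outside degree \<open>k\<close> both summands vanish for reasons of
          length.\<close>
        then have "(P - {i}, Q - {i}) \<notin> graded_pairs ?U (int k - 2)" if "i \<in> P \<inter> Q" for i
          using graded_pairs_remove[of ?U P Q i "int k - 2"] that x PQ by simp
        then have "lefschetz ?e x = 0"
          using word_outside[OF f rem, of _ True True] by (simp add: lefschetz_def PQ)
        then show ?thesis using word_outside[OF f x, of False False] False by simp
      qed
      have "weight x * ?b x = 0"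
        using b[OF x] weight_eq_0_iff[of x "int k - 1"] level_subset_graded_pairs by (cases "x \<in> level ?U (int k - 1)") auto
      with lb le show "lefschetz ?b x = 0 \<and> weight x * ?a x + lefschetz ?e x = 0 \<and> weight x * ?b x = 0" by simp
    qed
  next
    assume A: "\<forall>x\<in>pairs. lefschetz ?b x = 0 \<and> weight x * ?a x + lefschetz ?e x = 0 \<and> weight x * ?b x = 0"
    have in_pairs: "x \<in> pairs" if "x \<in> graded_pairs ?U j" for x j
      using that graded_pairs_subset by blast
    have level: "x \<in> graded_pairs ?U j \<and> weight x = 0" if "x \<in> level ?U j" for x j
      using that weight_eq_0_iff[of x j] level_subset_graded_pairs by blast
    show ?R
    proof (intro conjI ballI)
      fix x assume "x \<in> off_level ?U (int k - 1)"
      then have x: "x \<in> graded_pairs ?U (int k - 1)" "x \<notin> level ?U (int k - 1)"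
        by (simp_all add: off_level_def)
      then have "x \<in> pairs" "weight x \<noteq> 0"
        using in_pairs[OF x(1)] weight_eq_0_iff[OF x(1)] by blast+
      then show "?b x = 0" using A by (metis mult_eq_0_iff)
    next
      fix x assume "x \<in> off_level ?U k"
      then have "x \<in> pairs" using in_pairs[of x "int k"] by (simp only: off_level_def Diff_iff)
      then show "weight x * ?a x + lefschetz ?e x = 0" using A by blast
    next
      fix x assume "x \<in> level ?U (int k + 1)"
      then show "lefschetz ?b x = 0" using A level in_pairs by blast
    next
      fix x assume "x \<in> level ?U k"
      then have "weight x = 0" "x \<in> pairs" using level in_pairs by blast+
      then show "lefschetz ?e x = 0" using A by (metis add_0 mult_zero_left)
    qed
  qed
  also have "\<dots> \<longleftrightarrow> differential f = (\<lambda>_. 0)" using cocycle_iff[OF f] by simp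
  finally show ?thesis .
qed

lemma cocycle_conditions_surjective:
  "cocycle_conditions k ` cochains k = supported_on (cocycle_index n k)"
proof (intro equalityI subsetI)
  fix h :: "nat \<times> nat set \<times> nat set \<Rightarrow> complex" assume h: "h \<in> supported_on (cocycle_index n k)"
  let ?U = "{1..n}"
  obtain b where b: "\<And>x. x \<in> rank_index ?U (int k - 1) \<Longrightarrow> rank_map ?U (int k - 1) b x = h (2, x)"
    by (rule rank_map_surjective[of ?U "int k - 1" "\<lambda>x. h (2, x)"]) auto
  obtain e where e: "e \<in> supported_on (level ?U (int k - 2))"
    "\<And>x. x \<in> rank_index ?U (int k - 2) \<Longrightarrow> rank_map ?U (int k - 2) e x = h (3, x)"
    by (rule rank_map_surjective[of ?U "int k - 2" "\<lambda>x. h (3, x)"]) auto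
  \<comment> \<open>b and e are preimages under \<open>rank_map\<close> in weight 0; elsewhere b is
    prescribed directly and e is zero. Division by the weight solves for a. In weight 0 the quotient
    takes the default value 0, and no condition involves a there.\<close>
  define g where "g = (\<lambda>((p, q), x). if p \<and> \<not> q then if x \<in> level ?U (int k - 1) then b x else h (0, x)
    else if p \<and> q then e x else if \<not> p \<and> \<not> q then h (1, x) / weight x else 0)"
  obtain f where f: "f \<in> cochains k"
    "\<And>p q x. ((p, q), x) \<in> cochain_index n k \<Longrightarrow> f (word p q x) = g ((p, q), x)"
    using cochain_with_values[of k g] by blast
  have fb: "f (word True False x) = (if x \<in> level ?U (int k - 1) then b x else h (0, x))"
    if "x \<in> graded_pairs ?U (int k - 1)" for x
    using f(2)[of True False x] that by (simp add: cochain_index_def g_def)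
  have fe: "f (word True True x) = e x" if "x \<in> graded_pairs ?U (int k - 2)" for x
    using f(2)[of True True x] that by (simp add: cochain_index_def g_def)
  have fa: "f (word False False x) = h (1, x) / weight x" if "x \<in> graded_pairs ?U k" for x
    using f(2)[of False False x] that by (simp add: cochain_index_def g_def)
  have "cocycle_conditions k f (t, x) = h (t, x)" for t x
  proof (cases "(t, x) \<in> cocycle_index n k")
    case False
    then have "h (t, x) = 0" using h unfolding supported_on_def by blast
    then show ?thesis using False by (simp add: cocycle_conditions_def)
  next
    case True
    then consider "t = 0" "x \<in> off_level ?U (int k - 1)" | "t = 1" "x \<in> off_level ?U k"
      | "t = 2" "x \<in> rank_index ?U (int k - 1)" | "t = 3" "x \<in> rank_index ?U (int k - 2)"
      by (auto simp: cocycle_index_def)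
    then show ?thesis
    proof cases
      case 1
      then show ?thesis using True fb by (simp add: cocycle_conditions_def off_level_def)
    next
      case 2
      obtain P Q where PQ: "x = (P, Q)" by (cases x)
      have PQU: "P \<subseteq> ?U" "Q \<subseteq> ?U" using 2 PQ by (auto simp: off_level_def graded_pairs_def)
      \<comment> \<open>Removing an index from both sets keeps the weight non-zero, where e
        vanishes; hence \<open>L e\<close> does not disturb the equation for a.\<close>
      have "f (word True True (P - {i}, Q - {i})) = 0" if "i \<in> P \<inter> Q" for i
      proof -
        have "(P - {i}, Q - {i}) \<in> graded_pairs ?U (int k - 2)" "(P - {i}, Q - {i}) \<notin> level ?U (int k - 2)"
          using 2(2) graded_pairs_remove[OF _ PQU that, of "int k - 2"] level_remove[OF _ PQU that, of "int k - 2"]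
          by (auto simp: off_level_def PQ)
        then show ?thesis using fe e(1) unfolding supported_on_def by simp
      qed
      then have "lefschetz (\<lambda>x. f (word True True x)) x = 0" by (simp add: lefschetz_def PQ)
      moreover have "weight x \<noteq> 0" using 2(2) weight_eq_0_iff[of x "int k"] by (auto simp: off_level_def)
      ultimately show ?thesis using 2 True fa by (simp add: cocycle_conditions_def off_level_def)
    next
      case 3
      have "rank_map ?U (int k - 1) (\<lambda>x. f (word True False x)) x = rank_map ?U (int k - 1) b x"
      proof (rule rank_map_cong[OF _ 3(2)])
        fix y assume y: "y \<in> level ?U (int k - 1)"
        show "f (word True False y) = b y"
          using fb[OF subsetD[OF level_subset_graded_pairs y]] y by simp
      qed simp
      then show ?thesis using 3 True b by (simp add: cocycle_conditions_def)
    next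
      case 4
      have "rank_map ?U (int k - 2) (\<lambda>x. f (word True True x)) x = rank_map ?U (int k - 2) e x"
      proof (rule rank_map_cong[OF _ 4(2)])
        fix y assume y: "y \<in> level ?U (int k - 2)"
        show "f (word True True y) = e y"
          by (rule fe[OF subsetD[OF level_subset_graded_pairs y]])
      qed simp
      then show ?thesis using 4 True e by (simp add: cocycle_conditions_def)
    qed
  qed
  then have "h = cocycle_conditions k f" by auto
  then show "h \<in> cocycle_conditions k ` cochains k" using f(1) by blast
qed (auto simp: supported_on_def cocycle_conditions_def)

section \<open>Cocycles, coboundaries and Betti numbers\<close>

lemma fdim_cocycles: "fdim (cocycles k) + card (cocycle_index n k) = card (cochain_index n k)"
proof -
  have "cocycles k = {f \<in> cochains k. cocycle_conditions k f = (\<lambda>_. 0)}"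
    using cocycle_conditions_kernel by (auto simp: cocycles_def)
  then show ?thesis
    using fdim_kernel_supported_on[OF linear_set_cochains linear_map_on_cocycle_conditions fdim_cochains(2)
        cocycle_conditions_surjective finite_cocycle_index] fdim_cochains(1) by simp
qed

lemma coboundaries_linear: "linear_set (coboundaries k)"
  by (cases k) (simp_all add: coboundaries_def linear_set_def[of "{\<lambda>_. 0}"]
      linear_set_image linear_set_cochains linear_map_on_differential)

text \<open>The rank of the differential is the number of independent conditions for cocycles one
  degree below.\<close>

lemma fdim_coboundaries: "fdim (coboundaries k) = card (cocycle_index n (int k - 1))"
proof (cases k)
  case 0
  have "coboundaries k = supported_on {}" by (auto simp: coboundaries_def 0 supported_on_def)
  moreover have "rank_index {1..n} (- 2) = {}" "rank_index {1..n} (- 3) = {}"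
    by (simp_all add: rank_index_def level_negative)
  then have "card (cocycle_index n (- 1)) = 0"
    by (simp add: card_cocycle_index off_level_negative)
  ultimately show ?thesis by (simp add: 0 fdim_supported_on(1))
next
  case (Suc j)
  have "fdim (coboundaries k) + fdim (cocycles j) = card (cochain_index n j)"
    using fdim_rank_nullity(1)[OF linear_set_cochains linear_map_on_differential fdim_cochains(2), of j]
    by (simp add: Suc coboundaries_def cocycles_def fdim_cochains(1))
  then show ?thesis using fdim_cocycles[of j] by (simp add: Suc)
qed

lemma linear_set_cocycles: "linear_set (cocycles k)"
  unfolding cocycles_def by (intro linear_set_kernel linear_set_cochains linear_map_on_differential)

lemma coboundaries_subset_cocycles: "coboundaries k \<subseteq> cocycles k"
proof (cases k)
  case 0
  then show ?thesis using linear_setD(1)[OF linear_set_cocycles] by (simp add: coboundaries_def)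
next
  case (Suc j)
  then show ?thesis
    using differential_cochains differential_differential by (auto simp: coboundaries_def cocycles_def)
qed

lemma betti_dimension: "betti k + fdim (coboundaries k) = fdim (cocycles k)"
proof -
  have "cocycle_space k = fspace (cocycles k)" by (simp add: cocycle_space_def fspace_def)
  moreover have "finite_dim (cocycles k)"
    by (rule finite_dim_subset[OF linear_set_cochains linear_set_cocycles _ fdim_cochains(2)])
       (auto simp: cocycles_def)
  ultimately show ?thesis
    unfolding betti_def cohomology_def
    by (simp add: dim_quotient_fspace linear_set_cocycles coboundaries_linear coboundaries_subset_cocycles)
qed

text \<open>All contributions of \<open>off_level\<close> cancel: the \<open>k\<close>-cochains
  contain those of degrees k, k - 1 twice and k - 2, and the conditions in degrees k and k - 1
  remove exactly these. Only weight 0 remains.\<close>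

lemma betti_eq:
  fixes l r :: "int \<Rightarrow> int"
  defines "l j \<equiv> int (card (level {1..n} j))" and "r j \<equiv> int (card (rank_index {1..n} j))"
  shows "int (betti k) = l k + 2 * l (int k - 1) + l (int k - 2) - r (int k - 1) - 2 * r (int k - 2) - r (int k - 3)"
proof -
  have "betti k + card (cocycle_index n (int k - 1)) + card (cocycle_index n k) = card (cochain_index n k)"
    using betti_dimension[of k] fdim_coboundaries[of k] fdim_cocycles[of k] by linarith
  then show ?thesis
    unfolding card_cochain_index card_cocycle_index l_def r_def
    by (simp add: card_graded_pairs)
qed

end

lemma binom_symmetric: "int n - j = i \<Longrightarrow> binom n i = binom n j"
proof (cases "j < 0 \<or> i < 0")
  case False
  moreover assume "int n - j = i"
  ultimately have "nat i = n - nat j" "nat j \<le> n" by linarith+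
  then show ?thesis using False binomial_symmetric[of "nat j" n] by (simp add: binom_def)
qed (auto simp: binom_def binomial_eq_0)

theorem theorem2:
  fixes scale :: "complex \<Rightarrow> 'a::ab_group_add \<Rightarrow> 'a"
    and bracket :: "'a \<Rightarrow> 'a \<Rightarrow> 'a"
    and X Y :: "nat \<Rightarrow> 'a"
    and n k :: nat
  assumes "diamond_lie_algebra scale bracket n X Y"
  shows "(even k \<longrightarrow>
           int (lie_algebra.betti scale bracket k) =
             \<bar>(binom n (int k div 2))\<^sup>2 - (binom n ((int k - 2) div 2))\<^sup>2\<bar>) \<and>
         (odd k \<longrightarrow>
           (k < n + 1 \<longrightarrow>
             int (lie_algebra.betti scale bracket k) =
               (binom n ((int k - 1) div 2))\<^sup>2 - (binom n ((int k - 3) div 2))\<^sup>2) \<and>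
           (k = n + 1 \<longrightarrow>
             int (lie_algebra.betti scale bracket (n + 1)) =
               2 * (binom n (int n div 2))\<^sup>2 - 2 * (binom n ((int n + 2) div 2))\<^sup>2) \<and>
           (k > n + 1 \<longrightarrow>
             int (lie_algebra.betti scale bracket k) =
               (binom n ((int k - 1) div 2))\<^sup>2 - (binom n ((int k + 1) div 2))\<^sup>2))"
proof -
  interpret diamond_lie_algebra scale bracket n X Y by (rule assms)
  define \<beta> where "\<beta> j = (binom n j)\<^sup>2" for j
  have level: "int (card (level {1..n} j)) = (if even j then \<beta> (j div 2) else 0)" for j
    using card_level[of "{1..n}" j] by (simp add: \<beta>_def)
  \<comment> \<open>The rank of the Lefschetz operator in degree \<open>j\<close>: that of an
    injective map below \<open>n\<close>, that of a surjective map from \<open>n\<close> on.\<close>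
  have rank: "int (card (rank_index {1..n} j)) =
      (if even j then if j < int n then \<beta> (j div 2) else \<beta> (j div 2 + 1) else 0)" for j
    using level[of j] level[of "j + 2"] by (cases "even j"; cases "j < int n") (simp_all add: rank_index_def)
  have sym: "\<beta> i = \<beta> j" if "i + j = int n" for i j
    using that binom_symmetric[of n j i] by (simp add: \<beta>_def)
  note betti = betti_eq[of k, unfolded level rank]
  show ?thesis
  proof (cases "even k")
    case True
    then obtain m where m: "k = 2 * m" by (auto elim: evenE)
    have "int (betti k) = \<beta> m + \<beta> (int m - 1) - 2 * (if 2 * int m - 2 < int n then \<beta> (int m - 1) else \<beta> m)"
      using betti by (simp add: m)
    \<comment> \<open>Either case gives the difference up to sign, and the sign is settled because a
      Betti number is non-negative.\<close>
    then have "int (betti k) = \<bar>\<beta> m - \<beta> (int m - 1)\<bar>"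
      by (auto split: if_splits)
    then show ?thesis by (simp add: m \<beta>_def)
  next
    case False
    then obtain m where m: "k = 2 * m + 1" by (auto elim: oddE)
    have "int (betti k) = 2 * \<beta> m - (if 2 * int m < int n then \<beta> m else \<beta> (int m + 1)) -
        (if 2 * int m - 2 < int n then \<beta> (int m - 1) else \<beta> m)"
      using betti by (simp add: m)
    moreover have "\<beta> (int m - 1) = \<beta> (int m + 1)" if "n = 2 * m"
      using that by (intro sym) simp
    \<comment> \<open>The two inequalities force n = 2m - 1, where m - 1 and m are
      complementary.\<close>
    moreover have "\<beta> (int m - 1) = \<beta> m" if "2 * int m - 2 < int n" "2 * m > n"
      using that by (intro sym) presburger
    ultimately have "2 * m < n \<longrightarrow> int (betti k) = \<beta> m - \<beta> (int m - 1)"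
      "n = 2 * m \<longrightarrow> int (betti k) = 2 * \<beta> m - 2 * \<beta> (int m + 1)"
      "2 * m > n \<longrightarrow> int (betti k) = \<beta> m - \<beta> (int m + 1)"
      by auto
    moreover have "(int k - 1) div 2 = int m" "(int k - 3) div 2 = int m - 1" "(int k + 1) div 2 = int m + 1"
      using m by auto
    moreover have "int n div 2 = int m" "(int n + 2) div 2 = int m + 1" if "n = 2 * m"
      using that by auto
    ultimately show ?thesis using m by (auto simp: \<beta>_def add.commute)
  qed
qed

end
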